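(* Let $k$ be an algebraically closed subfield of $\mathbb{C}$ and let $U_S\subset \mathrm{SL}_n(k)$ be a regular subgroup corresponding to the closed subset $S\subset R^+$. Then the toric boundary components of the orbit $\mathrm{SL}_n(k)\cdot p_{\tilde S}$ have codimension at least $2$ in the orbit closure, that is, $$\dim\bigl(\mathrm{SL}_n(k)\cdot(\overline{T\cdot p_{\tilde S}})\setminus \mathrm{SL}_n(k)\cdot p_{\tilde S}\bigr)\le \dim(\mathrm{SL}_n(k)\cdot p_{\tilde S})-2 .$$
   Context: $T\subset \mathrm{SL}_n(k)$ is the diagonal maximal torus, $R^+=\{\alpha_i-\alpha_j:1\le i<j\le n\}$ where $\alpha_i$ is the character of $T$ giving the $(i,i)$ entry; we write $(i,j)$ for $\alpha_i-\alpha_j$. A subset $S\subset R^+$ is closed if $(i,j),(j,l)\in S\Rightarrow (i,l)\in S$. The regular subgroup $U_S$ consists of the upper triangular matrices with $1$'s on the diagonal whose $(i,j)$ entry ($i<j$) is arbitrary if $(i,j)\in S$ and zero otherwise. For $1\le j\le n$ let $S_j=\{j\}\cup\{i:(i,j)\in S\}\subset\{1,\dots,n\}$, and let $\tilde S=\{S_{i_1}\cup\dots\cup S_{i_r}: 1\le i_1<\dots<i_r\le n\}$ be the family of all unions of the $S_j$'s ($r\ge1$). Let $e_1,\dots,e_n$ be the standard basis of $k^n$ and $$p_{\tilde S}=\bigoplus_{U\in\tilde S}\bigwedge_{i\in U}e_i\in \mathcal{W}_{\tilde S}=\bigoplus_{U\in\tilde S}\wedge^{|U|}k^n ,$$ with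 the natural action of $\mathrm{SL}_n(k)$ on $\mathcal{W}_{\tilde S}$. The set $\mathrm{SL}_n(k)\cdot(\overline{T\cdot p_{\tilde S}})$ is called the toric closure of the orbit, and the components of $\mathrm{SL}_n(k)\cdot(\overline{T\cdot p_{\tilde S}})\setminus \mathrm{SL}_n(k)\cdot p_{\tilde S}$ are the toric boundary components. *)

theory Defs
  imports
    "HOL-Analysis.Abstract_Topology"
    "HOL-Library.Extended_Real"
    "Jordan_Normal_Form.Determinant"
begin

section \<open>Zariski topology and dimension\<close>

text \<open>Affine space over a field \<open>'k\<close> with coordinates indexed by \<open>A\<close> is \<open>A \<rightarrow>\<^sub>E UNIV\<close>.
  Its polynomial functions are the algebra generated by the coordinate functions; closed sets are
  common zero loci of families of polynomial functions.\<close>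

inductive_set polynomial_functions :: "'i set \<Rightarrow> (('i \<Rightarrow> 'k::comm_ring_1) \<Rightarrow> 'k) set"
  for A :: "'i set" where
  const: "(\<lambda>_. c) \<in> polynomial_functions A"
| coord: "i \<in> A \<Longrightarrow> (\<lambda>v. v i) \<in> polynomial_functions A"
| add: "f \<in> polynomial_functions A \<Longrightarrow> g \<in> polynomial_functions A \<Longrightarrow>
    (\<lambda>v. f v + g v) \<in> polynomial_functions A"
| mult: "f \<in> polynomial_functions A \<Longrightarrow> g \<in> polynomial_functions A \<Longrightarrow>
    (\<lambda>v. f v * g v) \<in> polynomial_functions A"

definition zero_locus :: "'i set \<Rightarrow> (('i \<Rightarrow> 'k::idom) \<Rightarrow> 'k) set \<Rightarrow> ('i \<Rightarrow> 'k) set" where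
  "zero_locus A F = {v \<in> A \<rightarrow>\<^sub>E UNIV. \<forall>f\<in>F. f v = 0}"

definition zariski :: "'i set \<Rightarrow> ('i \<Rightarrow> 'k::idom) topology" where
  "zariski A = topology (\<lambda>X. \<exists>F \<subseteq> polynomial_functions A. X = (A \<rightarrow>\<^sub>E UNIV) - zero_locus A F)"

lemma openin_zariski:
  fixes X :: "('i \<Rightarrow> 'k::idom) set"
  shows "openin (zariski A) X \<longleftrightarrow>
    (\<exists>F \<subseteq> polynomial_functions A. X = (A \<rightarrow>\<^sub>E UNIV) - zero_locus A F)"
proof -
  let ?P = "polynomial_functions A :: (('i \<Rightarrow> 'k) \<Rightarrow> 'k) set"
  let ?W = "A \<rightarrow>\<^sub>E UNIV :: ('i \<Rightarrow> 'k) set"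
  let ?L = "\<lambda>X. \<exists>F \<subseteq> ?P. X = ?W - zero_locus A F"
  have nonzero: "v \<in> ?W - zero_locus A F \<longleftrightarrow> v \<in> ?W \<and> (\<exists>f\<in>F. f v \<noteq> 0)" for v F
    by (auto simp: zero_locus_def)
  have "?L (X \<inter> Y)" if X: "?L X" and Y: "?L Y" for X Y
  proof -
    obtain F G where F: "F \<subseteq> ?P" "X = ?W - zero_locus A F"
      and G: "G \<subseteq> ?P" "Y = ?W - zero_locus A G"
      using X Y by blast
    let ?H = "{\<lambda>v. f v * g v | f g. f \<in> F \<and> g \<in> G}"
    have "?H \<subseteq> ?P" using F G by (auto intro: polynomial_functions.mult)
    moreover have "X \<inter> Y = ?W - zero_locus A ?H"
    proof (rule Set.set_eqI, rule iffI)
      fix v assume "v \<in> X \<inter> Y"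
      then obtain f g where "v \<in> ?W" "f \<in> F" "g \<in> G" "f v * g v \<noteq> 0"
        using F G by (auto simp: zero_locus_def)
      moreover have "(\<lambda>v. f v * g v) \<in> ?H" using \<open>f \<in> F\<close> \<open>g \<in> G\<close> by blast
      ultimately have "\<exists>h\<in>?H. h v \<noteq> 0" by (rule_tac bexI)
      then show "v \<in> ?W - zero_locus A ?H" using \<open>v \<in> ?W\<close> by (intro iffD2[OF nonzero] conjI)
    next
      fix v assume "v \<in> ?W - zero_locus A ?H"
      then show "v \<in> X \<inter> Y" using F G by (auto simp: zero_locus_def)
    qed
    ultimately show ?thesis by blast
  qed
  moreover have "?L (\<Union>\<K>)" if \<K>: "\<forall>K\<in>\<K>. ?L K" for \<K>
  proof -
    obtain F where F: "\<forall>K\<in>\<K>. F K \<subseteq> ?P \<and> K = ?W - zero_locus A (F K)"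
      using bchoice[OF \<K>] by blast
    have "(\<lambda>K. ?W - zero_locus A (F K)) ` \<K> = id ` \<K>"
      by (rule image_cong) (use F in simp_all)
    then have "\<Union>\<K> = (\<Union>K\<in>\<K>. ?W - zero_locus A (F K))" by simp
    also have "\<dots> = ?W - zero_locus A (\<Union>K\<in>\<K>. F K)" by (auto simp: zero_locus_def)
    finally have "\<Union>\<K> = ?W - zero_locus A (\<Union>K\<in>\<K>. F K)" .
    moreover have "(\<Union>K\<in>\<K>. F K) \<subseteq> ?P" using F by (intro UN_least) simp
    ultimately show ?thesis by (intro exI conjI)
  qed
  ultimately have "istopology ?L" by (simp add: istopology_def)
  then show ?thesis by (simp add: zariski_def)
qed

lemma topspace_zariski [simp]:
  "topspace (zariski A) = (A \<rightarrow>\<^sub>E UNIV :: ('i \<Rightarrow> 'k::idom) set)"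
proof
  show "topspace (zariski A) \<subseteq> (A \<rightarrow>\<^sub>E UNIV :: ('i \<Rightarrow> 'k) set)"
    by (auto simp: topspace_def openin_zariski)
  have "openin (zariski A) (A \<rightarrow>\<^sub>E UNIV :: ('i \<Rightarrow> 'k) set)"
    unfolding openin_zariski
    by (rule exI[of _ "{\<lambda>_. 1}"]) (auto simp: zero_locus_def polynomial_functions.const)
  then show "(A \<rightarrow>\<^sub>E UNIV :: ('i \<Rightarrow> 'k) set) \<subseteq> topspace (zariski A)"
    by (rule openin_subset)
qed

lemma closedin_zariski:
  fixes X :: "('i \<Rightarrow> 'k::idom) set"
  shows "closedin (zariski A) X \<longleftrightarrow> (\<exists>F \<subseteq> polynomial_functions A. X = zero_locus A F)"
proof -
  let ?W = "A \<rightarrow>\<^sub>E UNIV :: ('i \<Rightarrow> 'k) set"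
  have sub: "zero_locus A F \<subseteq> ?W" for F :: "(('i \<Rightarrow> 'k) \<Rightarrow> 'k) set"
    by (auto simp: zero_locus_def)
  have "X \<subseteq> ?W \<and> ?W - X = ?W - zero_locus A F \<longleftrightarrow> X = zero_locus A F" for F
    using sub[of F] by auto
  then show ?thesis
    unfolding closedin_def openin_zariski topspace_zariski
    by (simp add: ex_simps(1,2)[symmetric] del: ex_simps) metis
qed

definition irreducible_in :: "'a topology \<Rightarrow> 'a set \<Rightarrow> bool" where
  "irreducible_in X Z \<longleftrightarrow> Z \<subseteq> topspace X \<and> Z \<noteq> {} \<and>
    (\<forall>C D. closedin X C \<and> closedin X D \<and> Z \<subseteq> C \<union> D \<longrightarrow> Z \<subseteq> C \<or> Z \<subseteq> D)"

text \<open>Krull dimension of a topological space. The empty space has dimension \<open>-\<infinity>\<close>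
  (supremum of the empty set).\<close>

definition krull_dim :: "'a topology \<Rightarrow> ereal" where
  "krull_dim X = Sup {ereal (real d) | d. \<exists>Z :: nat \<Rightarrow> 'a set.
     (\<forall>i\<le>d. closedin X (Z i) \<and> irreducible_in X (Z i)) \<and> (\<forall>i<d. Z i \<subset> Z (Suc i))}"

definition zariski_dim :: "'i set \<Rightarrow> ('i \<Rightarrow> 'k::idom) set \<Rightarrow> ereal" where
  "zariski_dim A Y = krull_dim (subtopology (zariski A) Y)"


section \<open>Groups, roots and the family of unions\<close>

text \<open>All indices are shifted to run over \<open>0, \<dots>, n - 1\<close>.\<close>

definition SL :: "nat \<Rightarrow> 'k::field mat set" where
  "SL n = {g \<in> carrier_mat n n. det g = 1}"

definition diag_torus :: "nat \<Rightarrow> 'k::field mat set" where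
  "diag_torus n = {t \<in> SL n. diagonal_mat t}"

text \<open>The pair \<open>(i, j)\<close> stands for the root \<open>\<alpha>\<^sub>i - \<alpha>\<^sub>j\<close>.\<close>

definition pos_roots :: "nat \<Rightarrow> (nat \<times> nat) set" where
  "pos_roots n = {(i, j). i < j \<and> j < n}"

definition closed_root_subset :: "nat \<Rightarrow> (nat \<times> nat) set \<Rightarrow> bool" where
  "closed_root_subset n S \<longleftrightarrow> S \<subseteq> pos_roots n \<and>
    (\<forall>i j l. (i, j) \<in> S \<and> (j, l) \<in> S \<longrightarrow> (i, l) \<in> S)"

definition regular_subgroup :: "nat \<Rightarrow> (nat \<times> nat) set \<Rightarrow> 'k::field mat set" where
  "regular_subgroup n S = {u \<in> carrier_mat n n. upper_triangular u \<and> (\<forall>i<n. u $$ (i, i) = 1) \<and>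
    (\<forall>i j. i < j \<and> j < n \<and> (i, j) \<notin> S \<longrightarrow> u $$ (i, j) = 0)}"

definition col_support :: "(nat \<times> nat) set \<Rightarrow> nat \<Rightarrow> nat set" where
  "col_support S j = insert j {i. (i, j) \<in> S}"

definition union_family :: "nat \<Rightarrow> (nat \<times> nat) set \<Rightarrow> nat set set" where
  "union_family n S = {\<Union>j\<in>J. col_support S j | J. J \<subseteq> {0..<n} \<and> J \<noteq> {}}"


section \<open>Exterior powers\<close>

text \<open>The exterior power \<open>\<Lambda>\<^sup>m k\<^sup>n\<close> has the basis \<open>e\<^sub>I\<close>, where \<open>I\<close> ranges over the \<open>m\<close>-element
  subsets of \<open>{0..<n}\<close> and \<open>e\<^sub>I\<close> is the wedge product of the \<open>e\<^sub>i\<close>, \<open>i \<in> I\<close>, in increasing order.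
  Vectors are represented by their coordinates \<open>nat set \<Rightarrow> 'k\<close> in this basis. The coordinate of
  \<open>v\<^sub>1 \<and> \<dots> \<and> v\<^sub>m\<close> at \<open>e\<^sub>I\<close> is the minor of the matrix with columns \<open>v\<^sub>1, \<dots>, v\<^sub>m\<close> in the rows \<open>I\<close>.\<close>

definition wedge :: "'k::comm_ring_1 vec list \<Rightarrow> nat set \<Rightarrow> 'k" where
  "wedge vs I = det (mat (length vs) (length vs) (\<lambda>(a, b). (vs ! b) $ (sorted_list_of_set I ! a)))"

definition wedge_basis :: "nat \<Rightarrow> nat set \<Rightarrow> nat set \<Rightarrow> 'k::comm_ring_1" where
  "wedge_basis n U = wedge (map (unit_vec n) (sorted_list_of_set U))"

lemma wedge_basis_eq:
  fixes U I :: "nat set"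
  assumes U: "U \<subseteq> {0..<n}" and I: "I \<subseteq> {0..<n}" and card: "card I = card U"
  shows "wedge_basis n U I = (if I = U then 1 else 0 :: 'k::idom)"
proof -
  let ?m = "card U" and ?r = "\<lambda>a. sorted_list_of_set I ! a" and ?c = "\<lambda>b. sorted_list_of_set U ! b"
  let ?M = "mat ?m ?m (\<lambda>(a, b). unit_vec n (?c b) $ ?r a) :: 'k mat"
  have fin: "finite U" "finite I" using U I finite_subset by auto
  have c: "?c b \<in> U" if "b < ?m" for b
    using that fin nth_mem[of b "sorted_list_of_set U"] by simp
  have r: "?r a \<in> I" if "a < ?m" for a
    using that fin card nth_mem[of a "sorted_list_of_set I"] by simp
  have entry: "?M $$ (a, b) = (if ?r a = ?c b then 1 else 0)" if "a < ?m" "b < ?m" for a b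
    using that r[of a] c[of b] U I by (auto simp: unit_vec_def)
  have "wedge_basis n U I = det ?M"
    unfolding wedge_basis_def wedge_def by (intro arg_cong[of _ _ det] eq_matI) auto
  also have "det ?M = (if I = U then 1 else 0)"
  proof (cases "I = U")
    case True
    have "?M = 1\<^sub>m ?m"
      using True entry by (intro eq_matI) (auto simp: nth_eq_iff_index_eq)
    then show ?thesis using True by simp
  next
    case False
    then obtain i where i: "i \<in> I" "i \<notin> U"
      using card fin by (metis card_subset_eq subsetI)
    then obtain a where a: "a < ?m" "?r a = i"
      using fin card by (metis in_set_conv_nth length_sorted_list_of_set set_sorted_list_of_set)
    have "(\<Prod>b = 0..<?m. ?M $$ (b, \<pi> b)) = 0" if "\<pi> permutes {0..<?m}" for \<pi>
    proof (rule prod_zero)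
      have "\<pi> a < ?m" using permutes_in_image[OF that, of a] a by simp
      then have "?M $$ (a, \<pi> a) = 0" using entry[OF a(1)] a c i by auto
      then show "\<exists>b\<in>{0..<?m}. ?M $$ (b, \<pi> b) = 0"
        using a by (meson atLeastLessThan_iff zero_le)
    qed simp
    then have "det ?M = 0"
      by (subst det_def'[OF mat_carrier]) (intro sum.neutral ballI, simp only: mem_Collect_eq mult_zero_right)
    then show ?thesis using False by simp
  qed
  finally show ?thesis .
qed

text \<open>Natural action on an exterior power: the linear map sending
  \<open>e\<^sub>J\<close>, \<open>J = {j\<^sub>1 < \<dots> < j\<^sub>m}\<close>, to \<open>g e\<^bsub>j\<^sub>1\<^esub> \<and> \<dots> \<and> g e\<^bsub>j\<^sub>m\<^esub>\<close>.\<close>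

definition ext_act :: "nat \<Rightarrow> nat \<Rightarrow> 'k::comm_ring_1 mat \<Rightarrow> (nat set \<Rightarrow> 'k) \<Rightarrow> nat set \<Rightarrow> 'k" where
  "ext_act n m g w I = (\<Sum>J | J \<subseteq> {0..<n} \<and> card J = m.
     w J * wedge (map (\<lambda>j. g *\<^sub>v unit_vec n j) (sorted_list_of_set J)) I)"

text \<open>The direct sum of the \<open>\<Lambda>\<^bsup>|U|\<^esup> k\<^sup>n\<close> over \<open>U \<in> \<F>\<close>: the coordinate \<open>(U, I)\<close> is the
  \<open>e\<^sub>I\<close>-coordinate of the summand belonging to \<open>U\<close>.\<close>

definition W_index :: "nat \<Rightarrow> nat set set \<Rightarrow> (nat set \<times> nat set) set" where
  "W_index n \<F> = {(U, I). U \<in> \<F> \<and> I \<subseteq> {0..<n} \<and> card I = card U}"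

definition W_act ::
  "nat \<Rightarrow> nat set set \<Rightarrow> 'k::field mat \<Rightarrow> (nat set \<times> nat set \<Rightarrow> 'k) \<Rightarrow> nat set \<times> nat set \<Rightarrow> 'k" where
  "W_act n \<F> g w = (\<lambda>(U, I) \<in> W_index n \<F>. ext_act n (card U) g (\<lambda>J. w (U, J)) I)"

definition p_vec :: "nat \<Rightarrow> nat set set \<Rightarrow> nat set \<times> nat set \<Rightarrow> 'k::field" where
  "p_vec n \<F> = (\<lambda>(U, I) \<in> W_index n \<F>. wedge_basis n U I)"


section \<open>Orbit and toric closure\<close>

definition SL_orbit :: "nat \<Rightarrow> nat set set \<Rightarrow> (nat set \<times> nat set \<Rightarrow> 'k::field) set" where
  "SL_orbit n \<F> = {W_act n \<F> g (p_vec n \<F>) | g. g \<in> SL n}"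

definition torus_orbit :: "nat \<Rightarrow> nat set set \<Rightarrow> (nat set \<times> nat set \<Rightarrow> 'k::field) set" where
  "torus_orbit n \<F> = {W_act n \<F> t (p_vec n \<F>) | t. t \<in> diag_torus n}"

definition toric_closure :: "nat \<Rightarrow> nat set set \<Rightarrow> (nat set \<times> nat set \<Rightarrow> 'k::field) set" where
  "toric_closure n \<F> = {W_act n \<F> g w | g w.
     g \<in> SL n \<and> w \<in> zariski (W_index n \<F>) closure_of torus_orbit n \<F>}"

end

theory Submission
  imports Defs "HOL-Library.Function_Algebras"
begin

text \<open>The dimension of the orbit of \<open>p\<close> is at least \<open>n\<^sup>2 - 1 - |S|\<close>, and that of the toric boundary
  is at most \<open>n\<^sup>2 - 3 - |S|\<close>.

  \<^bold>\<open>The boundary consists of finitely many orbits.\<close> Only the coordinates \<open>x\<^sub>U\<close> at \<open>e\<^sub>U\<close>, \<open>U\<close> in the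
  family, are nonzero on the torus orbit of \<open>p\<close>, where they satisfy monomial equations. So the
  support \<open>\<sigma>\<close> of a point \<open>w\<close> of the closure is closed under union and nonempty intersection, and
  every \<open>j\<close> is contained in a least member \<open>M\<^sub>j \<supseteq> S\<^sub>j\<close> of \<open>\<sigma>\<close>. Explicit torus elements show that \<open>w\<close> is
  in the torus orbit of \<open>p\<^sub>\<sigma> = \<Sum>U\<in>\<sigma>. e\<^sub>U\<close>, and even in that of \<open>p\<close> if the sets \<open>M\<^sub>j\<close> are distinct
  (\<open>torus_closure_point\<close>). Hence the boundary is covered by the orbits of those \<open>p\<^sub>\<sigma>\<close> for which
  \<open>M\<^sub>c = M\<^sub>d\<close> for some \<open>c \<noteq> d\<close> (\<open>toric_boundary_subset\<close>).

  \<^bold>\<open>These orbits are small.\<close> The vector \<open>g p\<^sub>\<sigma>\<close> does not change if multiples of the columns in \<open>M\<^sub>j\<close>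
  are added to column \<open>j\<close> of \<open>g\<close>. This gives the \<open>|S|\<close> directions of the regular subgroup and, as
  \<open>(c, d)\<close> and \<open>(d, c)\<close> are not both in \<open>S\<close>, at least one more. Scaling the columns \<open>c\<close> and \<open>d\<close> by
  inverse factors gives another one. So the fibres of \<open>g \<mapsto> g p\<^sub>\<sigma>\<close> have dimension at least
  \<open>|S| + 2\<close>.

  \<^bold>\<open>Dimensions are estimated by algebraic independence.\<close> A chain of irreducible closed sets of length
  \<open>d\<close> in \<open>Y\<close> provides \<open>d\<close> independent polynomials on \<open>Y\<close> (\<open>alg_indep_on_insert\<close>). If \<open>Y\<close> is the orbit
  of \<open>p\<^sub>\<sigma>\<close>, then these can be extended by \<open>det - 1\<close> and by \<open>|S| + 2\<close> matrix entries to
  independent polynomials on all \<open>n \<times> n\<close> matrices, because these entries take almost arbitrary values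
  on a general fibre (\<open>alg_indep_on_Un\<close>, \<open>degenerate_orbit_bound\<close>). There are at most \<open>n\<^sup>2\<close> such
  polynomials (\<open>alg_indep_on_card_le\<close>).

  \<^bold>\<open>The orbit of \<open>p\<close> is large.\<close> A flag of irreducible subsets is obtained from a chart, with one
  parameter for each matrix position outside of \<open>S\<close> except the last diagonal one, by switching on
  the parameters one at a time (\<open>chart_witness\<close>, \<open>zariski_dim_SL_orbit_ge\<close>).\<close>

section \<open>Polynomial functions\<close>

lemma polynomial_functions_cong:
  assumes "P \<in> polynomial_functions A" "\<And>i. i \<in> A \<Longrightarrow> v i = w i"
  shows "P v = P w"
  using assms by (induction) auto

lemma polynomial_functions_sum:
  assumes "\<And>x. x \<in> X \<Longrightarrow> f x \<in> polynomial_functions A"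
  shows "(\<lambda>v. \<Sum>x\<in>X. f x v) \<in> polynomial_functions A"
  using assms
  by (induction X rule: infinite_finite_induct) (auto intro: polynomial_functions.intros)

lemma polynomial_functions_prod:
  assumes "\<And>x. x \<in> X \<Longrightarrow> f x \<in> polynomial_functions A"
  shows "(\<lambda>v. \<Prod>x\<in>X. f x v) \<in> polynomial_functions A"
  using assms
  by (induction X rule: infinite_finite_induct) (auto intro: polynomial_functions.intros)

lemma polynomial_functions_power:
  assumes "f \<in> polynomial_functions A"
  shows "(\<lambda>v. f v ^ m) \<in> polynomial_functions A"
  using polynomial_functions_prod[of "{..<m}" "\<lambda>_. f" A] assms by simp

lemma polynomial_functions_diff:
  fixes f g :: "('i \<Rightarrow> 'k::comm_ring_1) \<Rightarrow> 'k"
  assumes "f \<in> polynomial_functions A" "g \<in> polynomial_functions A"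
  shows "(\<lambda>v. f v - g v) \<in> polynomial_functions A"
  using polynomial_functions.add[OF assms(1) polynomial_functions.mult[OF polynomial_functions.const[of "-1"] assms(2)]]
  by simp

lemma polynomial_functions_compose:
  assumes "P \<in> polynomial_functions I" "\<And>i. i \<in> I \<Longrightarrow> f i \<in> polynomial_functions A"
  shows "(\<lambda>v. P (\<lambda>i. f i v)) \<in> polynomial_functions A"
  using assms by (induction) (auto intro: polynomial_functions.intros)

text \<open>The ring of polynomial functions is an integral domain, because this is so in one variable:
  if \<open>f a \<noteq> 0\<close> and \<open>g b \<noteq> 0\<close>, then on the line through \<open>a\<close> and \<open>b\<close> both functions are
  given by nonzero univariate polynomials.\<close>

lemma polynomial_functions_mult_eq_0:
  fixes f g :: "('i \<Rightarrow> 'k::field) \<Rightarrow> 'k"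
  assumes inf: "infinite (UNIV :: 'k set)"
    and f: "f \<in> polynomial_functions A" and g: "g \<in> polynomial_functions A"
    and zero: "\<And>v. f v * g v = 0"
  shows "(\<forall>v. f v = 0) \<or> (\<forall>v. g v = 0)"
proof (rule ccontr)
  assume "\<not> ?thesis"
  then obtain a b where a: "f a \<noteq> 0" and b: "g b \<noteq> 0" by blast
  let ?line = "\<lambda>s i. a i + s * (b i - a i)"
  have line: "\<exists>p. \<forall>s. P (?line s) = poly p s" if "P \<in> polynomial_functions A" for P
    using that
  proof induction
    case (const c)
    show ?case by (rule exI[of _ "[:c:]"]) simp
  next
    case (coord i)
    show ?case by (rule exI[of _ "[:a i, b i - a i:]"]) simp
  next
    case (add f g)
    then show ?case by (metis poly_add)
  next
    case (mult f g)
    then show ?case by (metis poly_mult)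
  qed
  obtain p q where p: "\<And>s. f (?line s) = poly p s" and q: "\<And>s. g (?line s) = poly q s"
    using line[OF f] line[OF g] by blast
  have "p \<noteq> 0" using p[of 0] a by auto
  moreover have "q \<noteq> 0" using q[of 1] b by auto
  ultimately have "p * q \<noteq> 0" by simp
  moreover have "poly (p * q) s = 0" for s using zero[of "?line s"] p[of s] q[of s] by simp
  ultimately show False using poly_roots_finite[of "p * q"] inf by simp
qed

text \<open>Collecting the powers of one coordinate \<open>q\<close> makes it possible to divide by them, although
  polynomials are only given as functions here.\<close>

lemma polynomial_functions_insert_poly:
  fixes P :: "('i \<Rightarrow> 'k::comm_ring_1) \<Rightarrow> 'k"
  assumes "P \<in> polynomial_functions (insert q I)"
  shows "\<exists>c N. (\<forall>k. (\<lambda>v. coeff (c v) k) \<in> polynomial_functions I) \<and>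
    (\<forall>v. degree (c v) \<le> N) \<and> (\<forall>v. P v = poly (c v) (v q))"
  using assms
proof induction
  case (const a)
  have "(\<lambda>v. coeff [:a:] k) \<in> polynomial_functions I" for k :: nat
    by (rule polynomial_functions.const)
  then show ?case by (intro exI[of _ "\<lambda>_. [:a:]"] exI[of _ 0]) simp
next
  case (coord i)
  show ?case
  proof (cases "i = q")
    case True
    have "(\<lambda>v. coeff [:0, 1 :: 'k:] k) \<in> polynomial_functions I" for k :: nat
      by (rule polynomial_functions.const)
    then show ?thesis using True by (intro exI[of _ "\<lambda>_. [:0, 1:]"] exI[of _ 1]) simp
  next
    case False
    then have "(\<lambda>v. coeff [:v i :: 'k:] k) \<in> polynomial_functions I" for k
      using coord by (cases k) (auto intro: polynomial_functions.intros)
    then show ?thesis by (intro exI[of _ "\<lambda>v. [:v i:]"] exI[of _ 0]) simp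
  qed
next
  case (add f g)
  then obtain c N d M where
    "\<forall>k. (\<lambda>v. coeff (c v) k) \<in> polynomial_functions I" "\<forall>v. degree (c v) \<le> N"
    "\<forall>v. f v = poly (c v) (v q)"
    "\<forall>k. (\<lambda>v. coeff (d v) k) \<in> polynomial_functions I" "\<forall>v. degree (d v) \<le> M"
    "\<forall>v. g v = poly (d v) (v q)" by metis
  then show ?case
    by (intro exI[of _ "\<lambda>v. c v + d v"] exI[of _ "max N M"])
      (auto intro!: polynomial_functions.add degree_add_le intro: le_trans max.cobounded1 max.cobounded2)
next
  case (mult f g)
  then obtain c N d M where *:
    "\<forall>k. (\<lambda>v. coeff (c v) k) \<in> polynomial_functions I" "\<forall>v. degree (c v) \<le> N"
    "\<forall>v. f v = poly (c v) (v q)"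
    "\<forall>k. (\<lambda>v. coeff (d v) k) \<in> polynomial_functions I" "\<forall>v. degree (d v) \<le> M"
    "\<forall>v. g v = poly (d v) (v q)" by metis
  have "degree (c v * d v) \<le> N + M" for v
    using degree_mult_le[of "c v" "d v"] *(2,5) by (meson add_mono le_trans)
  with * show ?case
    by (intro exI[of _ "\<lambda>v. c v * d v"] exI[of _ "N + M"])
      (auto simp: coeff_mult intro!: polynomial_functions_sum polynomial_functions.mult)
qed

section \<open>Algebraic independence\<close>

text \<open>Over an infinite field polynomials are the same as polynomial functions, so the
  functions \<open>f i\<close> are algebraically independent on \<open>Y\<close> iff no nonzero polynomial function
  annihilates them.\<close>

definition alg_indep_on :: "'j set \<Rightarrow> ('j \<Rightarrow> 'a \<Rightarrow> 'k::comm_ring_1) \<Rightarrow> 'a set \<Rightarrow> bool" where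
  "alg_indep_on J f Y \<longleftrightarrow>
    (\<forall>P \<in> polynomial_functions J. (\<forall>y\<in>Y. P (\<lambda>j. f j y) = 0) \<longrightarrow> (\<forall>v. P v = 0))"

lemma alg_indep_onD:
  "alg_indep_on J f Y \<Longrightarrow> P \<in> polynomial_functions J \<Longrightarrow> (\<And>y. y \<in> Y \<Longrightarrow> P (\<lambda>j. f j y) = 0) \<Longrightarrow> P v = 0"
  by (auto simp: alg_indep_on_def)

lemma alg_indep_on_mono: "alg_indep_on J f Y \<Longrightarrow> Y \<subseteq> Z \<Longrightarrow> alg_indep_on J f Z"
  unfolding alg_indep_on_def by blast

lemma alg_indep_on_cong:
  assumes "alg_indep_on J f Y" "\<And>j y. j \<in> J \<Longrightarrow> y \<in> Y \<Longrightarrow> f j y = g j y"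
  shows "alg_indep_on J g Y"
  unfolding alg_indep_on_def
proof (intro ballI impI)
  fix P assume P: "P \<in> polynomial_functions J" "\<forall>y\<in>Y. P (\<lambda>j. g j y) = 0"
  have "P (\<lambda>j. f j y) = P (\<lambda>j. g j y)" if "y \<in> Y" for y
    using that assms(2) by (intro polynomial_functions_cong[OF P(1)]) auto
  then show "\<forall>v. P v = 0" using P alg_indep_onD[OF assms(1) P(1)] by auto
qed

lemma alg_indep_on_empty: "Y \<noteq> {} \<Longrightarrow> alg_indep_on {} f Y"
  unfolding alg_indep_on_def
proof (intro ballI impI allI)
  fix P :: "('b \<Rightarrow> 'c) \<Rightarrow> 'c" and v
  assume "Y \<noteq> {}" and P: "P \<in> polynomial_functions {}" "\<forall>y\<in>Y. P (\<lambda>j. f j y) = 0"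
  then obtain y where "y \<in> Y" by blast
  then show "P v = 0" using P polynomial_functions_cong[OF P(1), of v "\<lambda>j. f j y"] by auto
qed

text \<open>If each piece carried a relation, the product of the relations would hold everywhere.\<close>

lemma alg_indep_on_Union:
  fixes f :: "'j \<Rightarrow> 'a \<Rightarrow> 'k::field"
  assumes inf: "infinite (UNIV :: 'k set)" and fin: "finite X"
    and ind: "alg_indep_on J f (\<Union>x\<in>X. Y x)"
  shows "\<exists>x\<in>X. alg_indep_on J f (Y x)"
proof (rule ccontr)
  assume "\<not> ?thesis"
  then have "\<forall>x\<in>X. \<exists>P. P \<in> polynomial_functions J \<and> (\<forall>y\<in>Y x. P (\<lambda>j. f j y) = 0) \<and> (\<exists>v. P v \<noteq> 0)"
    unfolding alg_indep_on_def by blast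
  then obtain P where P: "\<And>x. x \<in> X \<Longrightarrow> P x \<in> polynomial_functions J"
    "\<And>x y. x \<in> X \<Longrightarrow> y \<in> Y x \<Longrightarrow> P x (\<lambda>j. f j y) = 0"
    "\<And>x. x \<in> X \<Longrightarrow> \<exists>v. P x v \<noteq> 0" by metis
  have "\<exists>v. (\<Prod>x\<in>X'. P x v) \<noteq> 0" if "X' \<subseteq> X" for X'
    using finite_subset[OF that fin] that
  proof (induction X' rule: finite_induct)
    case (insert x X')
    have "(\<lambda>v. \<Prod>x\<in>X'. P x v) \<in> polynomial_functions J"
      using insert.prems P(1) by (intro polynomial_functions_prod) auto
    moreover obtain v w where "(\<Prod>x\<in>X'. P x v) \<noteq> 0" "P x w \<noteq> 0"
      using insert P(3)[of x] by blast
    ultimately obtain v where "P x v * (\<Prod>x\<in>X'. P x v) \<noteq> 0"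
      using polynomial_functions_mult_eq_0[OF inf, of "P x" J "\<lambda>v. \<Prod>x\<in>X'. P x v"]
        insert.prems P(1)[of x] by blast
    then show ?case using insert.hyps by (intro exI[of _ v]) simp
  qed auto
  then obtain v where "(\<Prod>x\<in>X. P x v) \<noteq> 0" by blast
  moreover have "(\<Prod>x\<in>X. P x v) = 0"
  proof (rule alg_indep_onD[OF ind, where P = "\<lambda>v. \<Prod>x\<in>X. P x v"])
    show "(\<lambda>v. \<Prod>x\<in>X. P x v) \<in> polynomial_functions J" using P(1) by (rule polynomial_functions_prod)
  next
    fix y assume "y \<in> (\<Union>x\<in>X. Y x)"
    then obtain x where "x \<in> X" "y \<in> Y x" by blast
    then show "(\<Prod>x\<in>X. P x (\<lambda>j. f j y)) = 0" using P(2) fin by (intro prod_zero) auto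
  qed
  ultimately show False by contradiction
qed


lemma poly_eq_sum_atMost:
  fixes p :: "'k::comm_ring_1 poly"
  assumes "degree p \<le> N"
  shows "poly p x = (\<Sum>k\<le>N. coeff p k * x ^ k)"
proof -
  have "poly p x = (\<Sum>k\<le>degree p. coeff p k * x ^ k)" by (rule poly_altdef)
  also have "\<dots> = (\<Sum>k\<le>N. coeff p k * x ^ k)"
    using assms by (intro sum.mono_neutral_left) (auto simp: coeff_eq_0)
  finally show ?thesis .
qed

text \<open>This is why transcendence degree grows strictly along a chain of irreducible closed sets.
  A relation on \<open>Z\<^sub>1\<close> may be divided by a power of \<open>f q\<close> until its part of degree \<open>0\<close> in
  \<open>f q\<close> is nonzero; restricted to \<open>Z\<^sub>0\<close>, where \<open>f q\<close> vanishes, that part becomes a relation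
  between the \<open>f j\<close> with \<open>j \<in> J\<close>.\<close>

lemma alg_indep_on_insert:
  fixes f :: "'j \<Rightarrow> ('i \<Rightarrow> 'k::field) \<Rightarrow> 'k"
  assumes ind: "alg_indep_on J f Z\<^sub>0" and sub: "Z\<^sub>0 \<subseteq> Z\<^sub>1" and q: "q \<notin> J"
    and f: "\<And>j. j \<in> J \<Longrightarrow> f j \<in> polynomial_functions A"
    and h: "f q \<in> polynomial_functions A"
    and h0: "\<And>z. z \<in> Z\<^sub>0 \<Longrightarrow> f q z = 0"
    and h1: "\<exists>z\<in>Z\<^sub>1. f q z \<noteq> 0"
    and prime: "\<And>F G. F \<in> polynomial_functions A \<Longrightarrow> G \<in> polynomial_functions A \<Longrightarrow>
      (\<forall>z\<in>Z\<^sub>1. F z * G z = 0) \<Longrightarrow> (\<forall>z\<in>Z\<^sub>1. F z = 0) \<or> (\<forall>z\<in>Z\<^sub>1. G z = 0)"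
  shows "alg_indep_on (insert q J) f Z\<^sub>1"
  unfolding alg_indep_on_def
proof (intro ballI impI, rule ccontr)
  fix P assume P: "P \<in> polynomial_functions (insert q J)" and rel: "\<forall>z\<in>Z\<^sub>1. P (\<lambda>j. f j z) = 0"
    and "\<not> (\<forall>v. P v = 0)"
  then obtain v\<^sub>0 where v0: "P v\<^sub>0 \<noteq> 0" by blast
  obtain c N where c: "\<And>k. (\<lambda>v. coeff (c v) k) \<in> polynomial_functions J"
    and N: "\<And>v. degree (c v) \<le> N" and Pc: "\<And>v. P v = poly (c v) (v q)"
    using polynomial_functions_insert_poly[OF P] by auto
  define m where "m = (LEAST k. \<exists>v. coeff (c v) k \<noteq> 0)"
  have "\<exists>k v. coeff (c v) k \<noteq> 0"
  proof (rule ccontr)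
    assume "\<not> ?thesis"
    then have "c v\<^sub>0 = 0" by (intro poly_eqI) simp
    then show False using v0 Pc by simp
  qed
  then have m: "\<exists>v. coeff (c v) m \<noteq> 0" unfolding m_def by (rule LeastI_ex)
  have below: "coeff (c v) k = 0" if "k < m" for k v
    using not_less_Least that unfolding m_def by blast
  have factor: "c v = monom 1 m * poly_shift m (c v)" for v
    by (intro poly_eqI) (simp add: coeff_monom_mult coeff_poly_shift below)
  let ?v = "\<lambda>z j. f j z"
  let ?G = "\<lambda>z. poly (poly_shift m (c (?v z))) (f q z)"
  have degG: "degree (poly_shift m (c v)) \<le> N" for v
    using N[of v] by (intro degree_le) (simp add: coeff_poly_shift coeff_eq_0)
  have "(\<lambda>z. f q z ^ m) \<in> polynomial_functions A" by (rule polynomial_functions_power[OF h])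
  moreover have "?G \<in> polynomial_functions A"
    unfolding poly_eq_sum_atMost[OF degG] coeff_poly_shift
    by (intro polynomial_functions_sum polynomial_functions.mult polynomial_functions_power h
        polynomial_functions_compose[OF c] f)
  moreover have "\<forall>z\<in>Z\<^sub>1. f q z ^ m * ?G z = 0"
  proof
    fix z assume "z \<in> Z\<^sub>1"
    then have "poly (c (?v z)) (f q z) = 0" using rel Pc by simp
    then show "f q z ^ m * ?G z = 0" by (subst (asm) factor) (simp add: poly_monom)
  qed
  moreover have "\<not> (\<forall>z\<in>Z\<^sub>1. f q z ^ m = 0)" using h1 by auto
  ultimately have G0: "\<forall>z\<in>Z\<^sub>1. ?G z = 0" using prime by blast
  have "coeff (c v) m = 0" for v
  proof (rule alg_indep_onD[OF ind c])
    fix z assume z: "z \<in> Z\<^sub>0"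
    have "?G z = 0" using G0 sub z by auto
    then show "coeff (c (?v z)) m = 0" by (simp add: h0[OF z] poly_0_coeff_0 coeff_poly_shift)
  qed
  then show False using m by blast
qed

text \<open>A fibre argument: if \<open>J\<^sub>1\<close> is independent and, for generic \<open>y\<close>, the functions
  \<open>f j\<close>, \<open>j \<in> J\<^sub>2\<close>, take almost all values on the common fibre of the \<open>f i\<close>, \<open>i \<in> J\<^sub>1\<close>,
  through \<open>y\<close>, then a relation between all of them has coefficients that vanish identically. Here
  generic means \<open>z y \<noteq> 0\<close>, and almost all means away from the zero set of \<open>l\<close>.\<close>

lemma alg_indep_on_Un:
  fixes f :: "'j \<Rightarrow> ('i \<Rightarrow> 'k::field) \<Rightarrow> 'k"
  assumes inf: "infinite (UNIV :: 'k set)"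
    and ind: "alg_indep_on J\<^sub>1 f UNIV" and disj: "J\<^sub>1 \<inter> J\<^sub>2 = {}"
    and f: "\<And>j. j \<in> J\<^sub>1 \<Longrightarrow> f j \<in> polynomial_functions A"
    and z: "z \<in> polynomial_functions A" "z y\<^sub>0 \<noteq> 0"
    and fibre: "\<And>y. z y \<noteq> 0 \<Longrightarrow> \<exists>l \<in> polynomial_functions J\<^sub>2. (\<exists>u. l u \<noteq> 0) \<and>
      (\<forall>u. l u \<noteq> 0 \<longrightarrow> (\<exists>y'. (\<forall>j\<in>J\<^sub>1. f j y' = f j y) \<and> (\<forall>j\<in>J\<^sub>2. f j y' = u j)))"
  shows "alg_indep_on (J\<^sub>1 \<union> J\<^sub>2) f UNIV"
  unfolding alg_indep_on_def
proof (intro ballI impI allI)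
  fix P v assume P: "P \<in> polynomial_functions (J\<^sub>1 \<union> J\<^sub>2)" and rel: "\<forall>y\<in>UNIV. P (\<lambda>j. f j y) = 0"
  let ?mix = "\<lambda>x u j. if j \<in> J\<^sub>2 then u j else x j"
  have mix: "(\<lambda>w. P (?mix (a w) (b w))) \<in> polynomial_functions B"
    if "\<And>j. j \<in> J\<^sub>1 - J\<^sub>2 \<Longrightarrow> (\<lambda>w. a w j) \<in> polynomial_functions B"
      "\<And>j. j \<in> J\<^sub>2 \<Longrightarrow> (\<lambda>w. b w j) \<in> polynomial_functions B" for a b and B :: "'l set"
    by (rule polynomial_functions_compose[OF P], rename_tac j, case_tac "j \<in> J\<^sub>2") (use that in auto)
  have generic: "P (?mix (\<lambda>j. f j y) u) = 0" if y: "z y \<noteq> 0" for y u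
  proof -
    obtain l where l: "l \<in> polynomial_functions J\<^sub>2" "\<exists>u. l u \<noteq> 0"
      and fib: "\<And>u. l u \<noteq> 0 \<Longrightarrow> \<exists>y'. (\<forall>j\<in>J\<^sub>1. f j y' = f j y) \<and> (\<forall>j\<in>J\<^sub>2. f j y' = u j)"
      using fibre[OF y] by auto
    have "(\<lambda>u. P (?mix (\<lambda>j. f j y) u)) \<in> polynomial_functions J\<^sub>2"
      by (rule mix) (auto intro: polynomial_functions.intros)
    moreover have "l u * P (?mix (\<lambda>j. f j y) u) = 0" for u
    proof (cases "l u = 0")
      case False
      then obtain y' where "\<forall>j\<in>J\<^sub>1. f j y' = f j y" "\<forall>j\<in>J\<^sub>2. f j y' = u j" using fib by blast
      then have "P (?mix (\<lambda>j. f j y) u) = P (\<lambda>j. f j y')"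
        using disj by (intro polynomial_functions_cong[OF P]) auto
      then show ?thesis using rel by simp
    qed simp
    ultimately show ?thesis using polynomial_functions_mult_eq_0[OF inf l(1)] l(2) by blast
  qed
  have "P (?mix v v) = 0"
  proof (rule alg_indep_onD[OF ind, where P = "\<lambda>x. P (?mix x v)"])
    show Pmix: "(\<lambda>x. P (?mix x v)) \<in> polynomial_functions J\<^sub>1"
      by (rule mix) (use disj in \<open>auto intro: polynomial_functions.intros\<close>)
    fix y
    have "(\<lambda>y. P (?mix (\<lambda>j. f j y) v)) \<in> polynomial_functions A"
      by (rule polynomial_functions_compose[OF Pmix f])
    moreover have "z y * P (?mix (\<lambda>j. f j y) v) = 0" for y using generic by auto
    ultimately show "P (?mix (\<lambda>j. f j y) v) = 0"
      using polynomial_functions_mult_eq_0[OF inf z(1)] z(2) by blast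
  qed
  then show "P v = 0" by (simp add: if_distrib cong: if_cong)
qed

section \<open>The number of independent polynomials\<close>

definition box_monomials :: "'i set \<Rightarrow> nat \<Rightarrow> (('i \<Rightarrow> 'k::comm_ring_1) \<Rightarrow> 'k) set" where
  "box_monomials A e = (\<lambda>b v. \<Prod>i\<in>A. v i ^ b i) ` (A \<rightarrow>\<^sub>E {..e})"

lemma finite_box_monomials: "finite A \<Longrightarrow> finite (box_monomials A e)"
  unfolding box_monomials_def by (intro finite_imageI finite_PiE) auto

lemma card_box_monomials_le: "finite A \<Longrightarrow> card (box_monomials A e) \<le> (e + 1) ^ card A"
  unfolding box_monomials_def
  by (rule le_trans[OF card_image_le]) (auto intro: finite_PiE simp: card_PiE)

interpretation fun_space: vector_space "\<lambda>c (f :: 'a \<Rightarrow> 'k::field) v. c * f v"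
  by unfold_locales (auto simp: fun_eq_iff algebra_simps)

lemma sum_fun_eval: "(\<Sum>x\<in>X. F x) y = (\<Sum>x\<in>X. F x y)"
  by (induction X rule: infinite_finite_induct) auto

lemma box_monomials_mono: "e \<le> e' \<Longrightarrow> box_monomials A e \<subseteq> box_monomials A e'"
  unfolding box_monomials_def by (intro image_mono PiE_mono) auto

lemma span_box_monomials_mult:
  fixes f g :: "('i \<Rightarrow> 'k::field) \<Rightarrow> 'k"
  assumes f: "f \<in> fun_space.span (box_monomials A e)" and g: "g \<in> fun_space.span (box_monomials A e')"
  shows "(\<lambda>v. f v * g v) \<in> fun_space.span (box_monomials A (e + e'))"
  using f
proof (induction rule: fun_space.span_induct)
  case base
  show ?case
    by (rule fun_space.subspaceI)
      (auto simp: zero_fun_def plus_fun_def algebra_simps fun_space.span_zero[unfolded zero_fun_def]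
        dest: fun_space.span_add[unfolded plus_fun_def] fun_space.span_scale)
next
  case (step m)
  from g show ?case
  proof (induction rule: fun_space.span_induct)
    case base
    show ?case
      by (rule fun_space.subspaceI)
        (auto simp: zero_fun_def plus_fun_def algebra_simps fun_space.span_zero[unfolded zero_fun_def]
          dest: fun_space.span_add[unfolded plus_fun_def] fun_space.span_scale)
  next
    case (step m')
    obtain b b' where b: "m = (\<lambda>v. \<Prod>i\<in>A. v i ^ b i)" "b \<in> A \<rightarrow>\<^sub>E {..e}"
      "m' = (\<lambda>v. \<Prod>i\<in>A. v i ^ b' i)" "b' \<in> A \<rightarrow>\<^sub>E {..e'}"
      using step \<open>m \<in> box_monomials A e\<close> unfolding box_monomials_def by blast
    have "(\<lambda>v. m v * m' v) = (\<lambda>v. \<Prod>i\<in>A. v i ^ (\<lambda>i\<in>A. b i + b' i) i)"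
      unfolding b by (auto simp: power_add prod.distrib intro!: prod.cong)
    moreover have "(\<lambda>i\<in>A. b i + b' i) \<in> A \<rightarrow>\<^sub>E {..e + e'}"
      using b by (auto simp: PiE_iff intro: add_mono)
    ultimately show ?case
      unfolding box_monomials_def by (intro fun_space.span_base) (rule image_eqI)
  qed
qed

lemma span_box_monomials_mono:
  "f \<in> fun_space.span (box_monomials A e) \<Longrightarrow> e \<le> e' \<Longrightarrow> f \<in> fun_space.span (box_monomials A e')"
  using fun_space.span_mono[OF box_monomials_mono] by blast

lemma const_in_span_box_monomials: "(\<lambda>_. c) \<in> fun_space.span (box_monomials A e)"
proof -
  have "(\<lambda>v. \<Prod>i\<in>A. v i ^ (\<lambda>i\<in>A. 0) i) \<in> box_monomials A e"
    unfolding box_monomials_def by (intro imageI) auto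
  then have "(\<lambda>_. 1) \<in> box_monomials A e" by (simp cong: prod.cong)
  from fun_space.span_scale[OF fun_space.span_base[OF this], of c] show ?thesis by simp
qed

lemma polynomial_functions_in_span:
  fixes f :: "('i \<Rightarrow> 'k::field) \<Rightarrow> 'k"
  assumes "finite A" "f \<in> polynomial_functions A"
  shows "\<exists>e. f \<in> fun_space.span (box_monomials A e)"
  using assms(2)
proof induction
  case (const c)
  show ?case by (rule exI, rule const_in_span_box_monomials[of c A 0])
next
  case (coord i)
  have "(\<lambda>v. v i) = (\<lambda>v. \<Prod>j\<in>A. v j ^ (\<lambda>j\<in>A. if j = i then 1 else 0) j :: 'k)"
  proof
    fix v :: "'i \<Rightarrow> 'k"
    have "(\<Prod>j\<in>A. v j ^ (\<lambda>j\<in>A. if j = i then 1 else 0) j) = (\<Prod>j\<in>A. if j = i then v j else 1)"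
      by (intro prod.cong) auto
    then show "v i = (\<Prod>j\<in>A. v j ^ (\<lambda>j\<in>A. if j = i then 1 else 0) j)"
      using coord \<open>finite A\<close> by simp
  qed
  moreover have "(\<lambda>j\<in>A. if j = i then 1 else 0) \<in> A \<rightarrow>\<^sub>E {..1 :: nat}" by auto
  ultimately have "(\<lambda>v. v i :: 'k) \<in> box_monomials A 1"
    unfolding box_monomials_def by (intro image_eqI[where x = "\<lambda>j\<in>A. if j = i then 1 else 0"])
  then show ?case using fun_space.span_base by blast
next
  case (add f g)
  then obtain e e' where "f \<in> fun_space.span (box_monomials A e)"
    "g \<in> fun_space.span (box_monomials A e')" by blast
  then have "f + g \<in> fun_space.span (box_monomials A (max e e'))"
    by (intro fun_space.span_add) (auto elim: span_box_monomials_mono)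
  then show ?case unfolding plus_fun_def by blast
next
  case (mult f g)
  then show ?case using span_box_monomials_mult by blast
qed

lemma span_box_monomials_prod:
  fixes f :: "'x \<Rightarrow> ('i \<Rightarrow> 'k::field) \<Rightarrow> 'k"
  assumes "finite X" "\<And>x. x \<in> X \<Longrightarrow> f x \<in> fun_space.span (box_monomials A e)"
  shows "(\<lambda>v. \<Prod>x\<in>X. f x v) \<in> fun_space.span (box_monomials A (card X * e))"
  using assms
proof (induction X rule: finite_induct)
  case empty
  then show ?case using const_in_span_box_monomials by simp
next
  case (insert x X)
  then show ?case
    using span_box_monomials_mult[of "f x" A e "\<lambda>v. \<Prod>x\<in>X. f x v" "card X * e"] by simp
qed

text \<open>Dimension count. If the functions \<open>f j\<close> are independent, then plugging them into the
  polynomials that single out the points of a grid of size \<open>(L + 1) ^ card J\<close> gives linearly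
  independent functions. Their degrees are at most a constant times \<open>L\<close>, so their number is at
  most a constant times \<open>(L + 1) ^ card A\<close>. This is impossible for large \<open>L\<close> if
  \<open>card J > card A\<close>.\<close>

lemma alg_indep_on_card_le:
  fixes f :: "'j \<Rightarrow> ('i \<Rightarrow> 'k::field) \<Rightarrow> 'k"
  assumes inf: "infinite (UNIV :: 'k set)" and J: "finite J" and A: "finite A"
    and f: "\<And>j. j \<in> J \<Longrightarrow> f j \<in> polynomial_functions A"
    and ind: "alg_indep_on J f UNIV"
  shows "card J \<le> card A"
proof -
  obtain E where E: "\<And>j. j \<in> J \<Longrightarrow> f j \<in> fun_space.span (box_monomials A E)"
  proof -
    have "\<forall>j\<in>J. \<exists>e. f j \<in> fun_space.span (box_monomials A e)"
      using polynomial_functions_in_span[OF A f] by blast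
    then obtain e where e: "\<And>j. j \<in> J \<Longrightarrow> f j \<in> fun_space.span (box_monomials A (e j))" by metis
    have "e j \<le> (\<Sum>j\<in>J. e j)" if "j \<in> J" for j using J that by (intro member_le_sum) auto
    then show thesis using that e span_box_monomials_mono by blast
  qed
  have bound: "(L + 1) ^ card J \<le> (card J * L * E + 1) ^ card A" for L
  proof -
    obtain B :: "'k set" where B: "finite B" "card B = L + 1"
      using infinite_arbitrarily_large[OF inf] by blast
    let ?pairs = "\<lambda>a. SIGMA j:J. B - {a j}"
    \<comment> \<open>Up to a constant, \<open>\<delta> a\<close> is the Lagrange polynomial of the grid point \<open>a\<close>.\<close>
    define \<delta> where "\<delta> a v = (\<Prod>(j, b) \<in> ?pairs a. v j - b)" for a and v :: "'j \<Rightarrow> 'k"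
    let ?grid = "J \<rightarrow>\<^sub>E B"
    have fin: "finite ?grid" using J B by (intro finite_PiE) auto
    have fin_pairs: "finite (?pairs a)" for a using J B by auto
    have \<delta>_poly: "\<delta> a \<in> polynomial_functions J" for a
      unfolding \<delta>_def
      by (intro polynomial_functions_prod)
        (auto intro!: polynomial_functions_diff polynomial_functions.intros)
    have \<delta>_self: "\<delta> a a \<noteq> 0" for a
      unfolding \<delta>_def using fin_pairs by (auto simp: prod_zero_iff)
    have \<delta>_other: "\<delta> a a' = 0" if a: "a \<in> ?grid" "a' \<in> ?grid" "a \<noteq> a'" for a a'
    proof -
      obtain j where "j \<in> J" "a j \<noteq> a' j" using a(3) PiE_ext[OF a(1,2)] by blast
      then have "(j, a' j) \<in> ?pairs a" using a(2) by auto
      then show ?thesis unfolding \<delta>_def using fin_pairs by (intro prod_zero bexI) auto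
    qed
    define D where "D a y = \<delta> a (\<lambda>j. f j y)" for a y
    have rel: "u a = 0" if "a \<in> ?grid" and u: "\<And>y. (\<Sum>a\<in>?grid. u a * D a y) = 0" for u a
    proof -
      have "(\<lambda>v. \<Sum>a\<in>?grid. u a * \<delta> a v) \<in> polynomial_functions J"
        by (intro polynomial_functions_sum polynomial_functions.mult polynomial_functions.const \<delta>_poly)
      from alg_indep_onD[OF ind this] u
      have "(\<Sum>a'\<in>?grid. u a' * \<delta> a' a) = 0" by (simp add: D_def)
      moreover have "(\<Sum>a'\<in>?grid. u a' * \<delta> a' a) = u a * \<delta> a a"
        using that(1) \<delta>_other by (subst sum.remove[OF fin, of a]) (auto intro!: sum.neutral)
      ultimately show ?thesis using \<delta>_self by simp
    qed
    have inj: "inj_on D ?grid"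
    proof (rule inj_onI, rule ccontr)
      fix a b assume ab: "a \<in> ?grid" "b \<in> ?grid" "D a = D b" "a \<noteq> b"
      have "(\<lambda>v. \<delta> a v - \<delta> b v) \<in> polynomial_functions J"
        by (intro polynomial_functions_diff \<delta>_poly)
      from alg_indep_onD[OF ind this] have "\<delta> a a - \<delta> b a = 0"
        using fun_cong[OF ab(3)] by (simp add: D_def)
      then show False using \<delta>_self[of a] \<delta>_other[of b a] ab by simp
    qed
    have "fun_space.independent (D ` ?grid)"
    proof
      assume "fun_space.dependent (D ` ?grid)"
      then obtain u v where v: "v \<in> D ` ?grid" "u v \<noteq> 0"
        and sum0: "(\<Sum>v\<in>D ` ?grid. (\<lambda>y. u v * v y)) = 0"
        using fun_space.dependent_finite[of "D ` ?grid"] fin by auto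
      have "(\<Sum>v\<in>D ` ?grid. u v * v y) = 0" for y
        using fun_cong[OF sum0, of y] unfolding sum_fun_eval by (simp only: zero_fun_apply)
      then have "(\<Sum>a\<in>?grid. u (D a) * D a y) = 0" for y
        by (simp add: sum.reindex[OF inj])
      from rel[OF _ this] v show False by auto
    qed
    moreover have "D a \<in> fun_space.span (box_monomials A (card J * L * E))" if a: "a \<in> ?grid" for a
    proof -
      have "card (?pairs a) = (\<Sum>j\<in>J. card (B - {a j}))" using J B by (intro card_SigmaI) auto
      also have "\<dots> = (\<Sum>j\<in>J. L)" using a B by (intro sum.cong) (auto simp: card_Diff_singleton_if)
      finally have card: "card (?pairs a) = card J * L" by simp
      have "(\<lambda>y. \<Prod>x\<in>?pairs a. f (fst x) y - snd x)
          \<in> fun_space.span (box_monomials A (card (?pairs a) * E))"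
      proof (rule span_box_monomials_prod[OF fin_pairs])
        fix x assume "x \<in> ?pairs a"
        then have "f (fst x) - (\<lambda>_. snd x) \<in> fun_space.span (box_monomials A E)"
          by (intro fun_space.span_diff E const_in_span_box_monomials) auto
        then show "(\<lambda>y. f (fst x) y - snd x) \<in> fun_space.span (box_monomials A E)"
          by (simp add: fun_diff_def)
      qed
      then show ?thesis unfolding D_def \<delta>_def card by (simp add: case_prod_beta)
    qed
    then have "D ` ?grid \<subseteq> fun_space.span (box_monomials A (card J * L * E))" by (rule image_subsetI)
    ultimately have "card (D ` ?grid) \<le> card (box_monomials A (card J * L * E) :: (('i \<Rightarrow> 'k) \<Rightarrow> 'k) set)"
      by (rule conjunct2[OF fun_space.independent_span_bound[OF finite_box_monomials[OF A]]])
    also have "\<dots> \<le> (card J * L * E + 1) ^ card A" by (rule card_box_monomials_le[OF A])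
    finally show ?thesis using J B by (simp add: card_image[OF inj] card_PiE)
  qed
  show ?thesis
  proof (rule ccontr)
    assume "\<not> ?thesis"
    then have less: "card A + 1 \<le> card J" by simp
    \<comment> \<open>With this \<open>C\<close>, the bound implies \<open>L + 1 \<le> C ^ card A\<close> for every \<open>L\<close>.\<close>
    define C where "C = card J * E + 1"
    define L where "L = C ^ card A"
    have "(L + 1) ^ card A * (L + 1) \<le> (L + 1) ^ card J"
      using power_increasing[OF less, of "L + 1"] by (simp add: algebra_simps)
    also have "\<dots> \<le> (card J * L * E + 1) ^ card A" by (rule bound)
    also have "\<dots> \<le> (C * (L + 1)) ^ card A"
      by (intro power_mono) (auto simp: C_def algebra_simps)
    also have "\<dots> = (L + 1) ^ card A * L" by (simp add: L_def power_mult_distrib del: mult_Suc_right)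
    finally show False by simp
  qed
qed

section \<open>Bounds for the Krull dimension\<close>

lemma closedin_zariski_subtopology:
  "closedin (subtopology (zariski A) Y) C \<longleftrightarrow> (\<exists>F \<subseteq> polynomial_functions A. C = zero_locus A F \<inter> Y)"
  unfolding closedin_subtopology closedin_zariski by blast

lemma irreducible_in_zariski_mult:
  fixes F G :: "('i \<Rightarrow> 'k::idom) \<Rightarrow> 'k"
  assumes irr: "irreducible_in (subtopology (zariski A) Y) Z"
    and F: "F \<in> polynomial_functions A" and G: "G \<in> polynomial_functions A"
    and zero: "\<forall>z\<in>Z. F z * G z = 0"
  shows "(\<forall>z\<in>Z. F z = 0) \<or> (\<forall>z\<in>Z. G z = 0)"
proof -
  let ?C = "\<lambda>F. zero_locus A {F} \<inter> Y"
  have closed: "closedin (subtopology (zariski A) Y) (?C F)" if "F \<in> polynomial_functions A" for F :: "('i \<Rightarrow> 'k) \<Rightarrow> 'k"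
    using that unfolding closedin_zariski_subtopology by (intro exI[of _ "{F}"]) auto
  have "Z \<subseteq> (A \<rightarrow>\<^sub>E UNIV) \<inter> Y" using irr by (simp add: irreducible_in_def)
  then have "Z \<subseteq> ?C F \<union> ?C G" using zero by (auto simp: zero_locus_def)
  then have "Z \<subseteq> ?C F \<or> Z \<subseteq> ?C G"
    using irr[unfolded irreducible_in_def, THEN conjunct2, THEN conjunct2, rule_format, of "?C F" "?C G"]
      closed[OF F] closed[OF G] by simp
  then show ?thesis by (auto simp: zero_locus_def)
qed

text \<open>Each step of the chain adds a polynomial that vanishes on \<open>Z i\<close> but not on \<open>Z (Suc i)\<close>.\<close>

lemma irreducible_chain_alg_indep:
  fixes A :: "'i set" and Z :: "nat \<Rightarrow> ('i \<Rightarrow> 'k::field) set" and e :: "nat \<Rightarrow> 'j"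
  assumes chain: "\<And>i. i \<le> d \<Longrightarrow> closedin (subtopology (zariski A) Y) (Z i)"
      "\<And>i. i \<le> d \<Longrightarrow> irreducible_in (subtopology (zariski A) Y) (Z i)"
      "\<And>i. i < d \<Longrightarrow> Z i \<subset> Z (Suc i)"
    and e: "inj e"
  shows "\<exists>f. (\<forall>i<d. f (e i) \<in> polynomial_functions A) \<and> alg_indep_on (e ` {..<d}) f (Z d)"
proof -
  have "\<exists>f. (\<forall>j<i. f (e j) \<in> polynomial_functions A) \<and> alg_indep_on (e ` {..<i}) f (Z i)"
    if "i \<le> d" for i
    using that
  proof (induction i)
    case 0
    have "Z 0 \<noteq> {}" using chain(2)[of 0] by (simp add: irreducible_in_def)
    then have "alg_indep_on {} undefined (Z 0)" by (rule alg_indep_on_empty)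
    then show ?case by auto
  next
    case (Suc i)
    then obtain f where f: "\<And>j. j < i \<Longrightarrow> f (e j) \<in> polynomial_functions A"
      and ind: "alg_indep_on (e ` {..<i}) f (Z i)" by auto
    obtain F where F: "F \<subseteq> polynomial_functions A" "Z i = zero_locus A F \<inter> Y"
      using chain(1)[of i] Suc.prems by (auto simp: closedin_zariski_subtopology)
    have sub: "Z i \<subset> Z (Suc i)" using chain(3) Suc.prems by simp
    then obtain z where z: "z \<in> Z (Suc i)" "z \<notin> Z i" by blast
    moreover have "Z (Suc i) \<subseteq> (A \<rightarrow>\<^sub>E UNIV) \<inter> Y"
      using chain(2)[of "Suc i"] Suc.prems by (simp add: irreducible_in_def)
    ultimately obtain h where h: "h \<in> F" "h z \<noteq> 0" using F by (auto simp: zero_locus_def)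
    let ?f = "f(e i := h)"
    have ne: "e j \<noteq> e i" if "j < i" for j using that e by (auto dest: injD)
    have "alg_indep_on (insert (e i) (e ` {..<i})) ?f (Z (Suc i))"
    proof (rule alg_indep_on_insert)
      show "alg_indep_on (e ` {..<i}) ?f (Z i)"
        using ne by (intro alg_indep_on_cong[OF ind]) auto
      show "Z i \<subseteq> Z (Suc i)" using sub by blast
      show "e i \<notin> e ` {..<i}" using ne by force
      show "?f j \<in> polynomial_functions A" if "j \<in> e ` {..<i}" for j using that f ne by auto
      show "?f (e i) \<in> polynomial_functions A" using h F by auto
      show "?f (e i) z = 0" if "z \<in> Z i" for z using that h F by (auto simp: zero_locus_def)
      show "\<exists>z\<in>Z (Suc i). ?f (e i) z \<noteq> 0" using z h by auto
      show "(\<forall>z\<in>Z (Suc i). F z = 0) \<or> (\<forall>z\<in>Z (Suc i). G z = 0)"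
        if "F \<in> polynomial_functions A" "G \<in> polynomial_functions A" "\<forall>z\<in>Z (Suc i). F z * G z = 0" for F G
        using irreducible_in_zariski_mult[OF chain(2) that] Suc.prems by simp
    qed
    then have "alg_indep_on (e ` {..<Suc i}) ?f (Z (Suc i))" by (simp add: lessThan_Suc)
    moreover have "?f (e j) \<in> polynomial_functions A" if "j < Suc i" for j
      using that f h F ne by (cases "j = i") auto
    ultimately show ?case by blast
  qed
  then show ?thesis by blast
qed

lemma zariski_dim_leI:
  fixes A :: "'i set" and Y :: "('i \<Rightarrow> 'k::field) set" and e :: "nat \<Rightarrow> 'j"
  assumes inf: "infinite (UNIV :: 'k set)" and e: "inj e"
    and X: "finite X" "Y \<subseteq> (\<Union>x\<in>X. Y' x)"
    and le: "\<And>x d f. x \<in> X \<Longrightarrow> (\<And>i. i < d \<Longrightarrow> f (e i) \<in> polynomial_functions A) \<Longrightarrow>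
      alg_indep_on (e ` {..<d}) f (Y' x) \<Longrightarrow> ereal (real d) \<le> b"
  shows "zariski_dim A Y \<le> b"
  unfolding zariski_dim_def krull_dim_def
proof (rule Sup_least)
  fix r assume "r \<in> {ereal (real d) | d. \<exists>Z :: nat \<Rightarrow> ('i \<Rightarrow> 'k) set.
     (\<forall>i\<le>d. closedin (subtopology (zariski A) Y) (Z i) \<and> irreducible_in (subtopology (zariski A) Y) (Z i)) \<and>
     (\<forall>i<d. Z i \<subset> Z (Suc i))}"
  then obtain d Z where r: "r = ereal (real d)"
    and Z: "\<And>i. i \<le> d \<Longrightarrow> closedin (subtopology (zariski A) Y) (Z i)"
      "\<And>i. i \<le> d \<Longrightarrow> irreducible_in (subtopology (zariski A) Y) (Z i)"
      "\<And>i. i < d \<Longrightarrow> Z i \<subset> Z (Suc i)" by blast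
  obtain f where f: "\<And>i. i < d \<Longrightarrow> f (e i) \<in> polynomial_functions A"
    and ind: "alg_indep_on (e ` {..<d}) f (Z d)"
    using irreducible_chain_alg_indep[of d A Y Z e] Z e by auto
  have "Z d \<subseteq> Y" using closedin_subset[OF Z(1)[of d]] by simp
  then obtain x where "x \<in> X" "alg_indep_on (e ` {..<d}) f (Y' x)"
    using alg_indep_on_Union[OF inf X(1) alg_indep_on_mono[OF ind]] X(2) by blast
  then show "r \<le> b" using le f r by auto
qed

text \<open>The sets \<open>V k\<close> need not be closed: their closures in \<open>Y\<close> form a chain, which is strict
  because of the functions \<open>h k\<close>.\<close>

lemma zariski_dim_geI:
  fixes A :: "'i set" and V :: "nat \<Rightarrow> ('i \<Rightarrow> 'k::field) set"
  assumes Y: "Y \<subseteq> A \<rightarrow>\<^sub>E UNIV" and V: "\<And>k. k \<le> d \<Longrightarrow> V k \<subseteq> Y" "\<And>k. k \<le> d \<Longrightarrow> V k \<noteq> {}"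
    and mono: "\<And>k. k < d \<Longrightarrow> V k \<subseteq> V (Suc k)"
    and prime: "\<And>k F G. k \<le> d \<Longrightarrow> F \<in> polynomial_functions A \<Longrightarrow> G \<in> polynomial_functions A \<Longrightarrow>
      (\<forall>z\<in>V k. F z * G z = 0) \<Longrightarrow> (\<forall>z\<in>V k. F z = 0) \<or> (\<forall>z\<in>V k. G z = 0)"
    and h: "\<And>k. k < d \<Longrightarrow> \<exists>h \<in> polynomial_functions A. (\<forall>z\<in>V k. h z = 0) \<and> (\<exists>z\<in>V (Suc k). h z \<noteq> 0)"
  shows "ereal (real d) \<le> zariski_dim A Y"
proof -
  let ?T = "subtopology (zariski A) Y"
  define I where "I k = {F \<in> polynomial_functions A. \<forall>z\<in>V k. F z = 0}" for k
  define Z where "Z k = zero_locus A (I k) \<inter> Y" for k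
  have VZ: "V k \<subseteq> Z k" if "k \<le> d" for k
    using V(1)[OF that] Y by (auto simp: Z_def I_def zero_locus_def)
  have closed: "closedin ?T (Z k)" for k
    unfolding closedin_zariski_subtopology Z_def I_def by (intro exI conjI refl) auto
  have "irreducible_in ?T (Z k)" if k: "k \<le> d" for k
    unfolding irreducible_in_def
  proof (intro conjI allI impI)
    show "Z k \<subseteq> topspace ?T" using closedin_subset[OF closed] .
    show "Z k \<noteq> {}" using VZ[OF k] V(2)[OF k] by blast
    fix C D assume CD: "closedin ?T C \<and> closedin ?T D \<and> Z k \<subseteq> C \<union> D"
    obtain F G where F: "F \<subseteq> polynomial_functions A" "C = zero_locus A F \<inter> Y"
      and G: "G \<subseteq> polynomial_functions A" "D = zero_locus A G \<inter> Y"
      using CD by (auto simp: closedin_zariski_subtopology)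
    show "Z k \<subseteq> C \<or> Z k \<subseteq> D"
    proof (rule ccontr)
      assume "\<not> ?thesis"
      then obtain f g x y where f: "f \<in> F" "x \<in> Z k" "f x \<noteq> 0" and g: "g \<in> G" "y \<in> Z k" "g y \<noteq> 0"
        using F G by (auto simp: Z_def zero_locus_def)
      have "\<not> (\<forall>z\<in>V k. f z = 0)" "\<not> (\<forall>z\<in>V k. g z = 0)"
        using f g F G by (auto simp: Z_def I_def zero_locus_def)
      moreover have "\<forall>z\<in>V k. f z * g z = 0"
        using VZ[OF k] CD F G f(1) g(1) by (fastforce simp: zero_locus_def)
      ultimately show False using prime[OF k] f(1) g(1) F G by blast
    qed
  qed
  moreover have "Z k \<subset> Z (Suc k)" if k: "k < d" for k
  proof -
    obtain g where g: "g \<in> polynomial_functions A" "\<forall>z\<in>V k. g z = 0" "\<exists>z\<in>V (Suc k). g z \<noteq> 0"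
      using h[OF k] by blast
    then have "g \<in> I k" by (simp add: I_def)
    then have "\<not> V (Suc k) \<subseteq> Z k" using g(3) by (auto simp: Z_def zero_locus_def)
    moreover have "Z k \<subseteq> Z (Suc k)"
      using mono[OF k] unfolding Z_def I_def zero_locus_def by blast
    ultimately show ?thesis using VZ[of "Suc k"] k by auto
  qed
  ultimately show ?thesis
    unfolding zariski_dim_def krull_dim_def using closed by (intro Sup_upper) blast
qed

section \<open>Minors\<close>

definition minor :: "(nat \<times> nat \<Rightarrow> 'k::comm_ring_1) \<Rightarrow> nat set \<Rightarrow> nat set \<Rightarrow> 'k" where
  "minor v I U = det (mat (card U) (card U)
    (\<lambda>(a, b). v (sorted_list_of_set I ! a, sorted_list_of_set U ! b)))"

lemma bij_betw_sorted_list_of_set: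
  "finite I \<Longrightarrow> bij_betw (\<lambda>a. sorted_list_of_set I ! a) {0..<card I} I"
  using bij_betw_nth[of "sorted_list_of_set I" "{0..<card I}" I] by (simp add: lessThan_atLeast0)

lemma sorted_list_of_set_nth_in:
  "finite I \<Longrightarrow> a < card I \<Longrightarrow> sorted_list_of_set I ! a \<in> I"
  using bij_betwE[OF bij_betw_sorted_list_of_set] by force

lemma sorted_list_of_set_nth_eq_iff:
  "finite I \<Longrightarrow> a < card I \<Longrightarrow> b < card I \<Longrightarrow>
    sorted_list_of_set I ! a = sorted_list_of_set I ! b \<longleftrightarrow> a = b"
  by (simp add: nth_eq_iff_index_eq)

lemma sum_sorted_list_of_set_nth:
  "finite I \<Longrightarrow> (\<Sum>a = 0..<card I. f (sorted_list_of_set I ! a)) = (\<Sum>i\<in>I. f i)"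
  by (rule sum.reindex_bij_betw[OF bij_betw_sorted_list_of_set])

lemma prod_sorted_list_of_set_nth:
  "finite I \<Longrightarrow> (\<Prod>a = 0..<card I. f (sorted_list_of_set I ! a)) = (\<Prod>i\<in>I. f i)"
  by (rule prod.reindex_bij_betw[OF bij_betw_sorted_list_of_set])

lemma minor_cong:
  assumes "finite I" "finite U" "card I = card U" "\<And>r s. r \<in> I \<Longrightarrow> s \<in> U \<Longrightarrow> v (r, s) = w (r, s)"
  shows "minor v I U = minor w I U"
  unfolding minor_def using assms
  by (intro arg_cong[of _ _ det] cong_mat) (auto simp: sorted_list_of_set_nth_in)

lemma minor_in_polynomial_functions:
  assumes "I \<subseteq> {0..<n}" "U \<subseteq> {0..<n}" "card I = card U"
  shows "(\<lambda>v. minor v I U) \<in> polynomial_functions ({0..<n} \<times> {0..<n})"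
proof -
  let ?m = "card U" and ?r = "\<lambda>a. sorted_list_of_set I ! a" and ?c = "\<lambda>b. sorted_list_of_set U ! b"
  have fin: "finite I" "finite U" using assms finite_subset by auto
  have "minor v I U = (\<Sum>\<pi> | \<pi> permutes {0..<?m}. signof \<pi> * (\<Prod>a = 0..<?m. v (?r a, ?c (\<pi> a))))"
    for v :: "nat \<times> nat \<Rightarrow> 'a"
    unfolding minor_def
    by (subst det_def'[OF mat_carrier], intro sum.cong refl arg_cong2[of _ _ _ _ "(*)"] prod.cong)
      (auto simp: permutes_in_image dest: permutes_in_image)
  moreover have "(\<lambda>v. v (?r a, ?c (\<pi> a))) \<in> polynomial_functions ({0..<n} \<times> {0..<n})"
    if "\<pi> permutes {0..<?m}" "a < ?m" for \<pi> a
    using that assms sorted_list_of_set_nth_in[OF fin(1), of a]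
      sorted_list_of_set_nth_in[OF fin(2), of "\<pi> a"] permutes_in_image[OF that(1), of a]
    by (intro polynomial_functions.coord) auto
  ultimately show ?thesis
    by (simp only:) (intro polynomial_functions_sum polynomial_functions.mult
        polynomial_functions.const polynomial_functions_prod, auto)
qed

lemma minor_full_eq_det: "minor v {0..<n} {0..<n} = det (mat n n v)"
  unfolding minor_def by (intro arg_cong[of _ _ det]) (auto intro!: cong_mat)

text \<open>The special case of the Cauchy-Binet formula in which the second factor maps the coordinate
  subspace of \<open>U\<close> into itself.\<close>

lemma minor_mult:
  fixes g h :: "nat \<times> nat \<Rightarrow> 'k::comm_ring_1"
  assumes I: "finite I" "card I = card U" and U: "U \<subseteq> {0..<n}"
    and h: "\<And>l s. l < n \<Longrightarrow> l \<notin> U \<Longrightarrow> s \<in> U \<Longrightarrow> h (l, s) = 0"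
  shows "minor (\<lambda>(r, s). \<Sum>l<n. g (r, l) * h (l, s)) I U = minor g I U * minor h U U"
proof -
  let ?m = "card U" and ?r = "\<lambda>a. sorted_list_of_set I ! a" and ?c = "\<lambda>b. sorted_list_of_set U ! b"
  have finU: "finite U" using U finite_subset by auto
  have entry: "(\<Sum>l<n. g (r, l) * h (l, s)) = (\<Sum>b = 0..<?m. g (r, ?c b) * h (?c b, s))"
    if "s \<in> U" for r s
  proof -
    have "(\<Sum>l<n. g (r, l) * h (l, s)) = (\<Sum>l\<in>U. g (r, l) * h (l, s))"
      using U h that by (intro sum.mono_neutral_right) auto
    then show ?thesis using sum_sorted_list_of_set_nth[OF finU, of "\<lambda>l. g (r, l) * h (l, s)"] by simp
  qed
  have "mat ?m ?m (\<lambda>(a, b). (\<lambda>(r, s). \<Sum>l<n. g (r, l) * h (l, s)) (?r a, ?c b)) =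
      mat ?m ?m (\<lambda>(a, b). g (?r a, ?c b)) * mat ?m ?m (\<lambda>(a, b). h (?c a, ?c b))"
    using sorted_list_of_set_nth_in[OF finU]
    by (intro eq_matI) (auto simp: entry scalar_prod_def intro!: sum.cong)
  then show ?thesis unfolding minor_def by (simp add: det_mult[of _ ?m])
qed

lemma minor_diagonal:
  assumes "finite U"
  shows "minor (\<lambda>(r, s). if r = s then t r else 0) U U = (\<Prod>i\<in>U. t i)"
proof -
  let ?c = "\<lambda>b. sorted_list_of_set U ! b"
  let ?M = "mat (card U) (card U) (\<lambda>(a, b). (\<lambda>(r, s). if r = s then t r else 0) (?c a, ?c b))"
  have "minor (\<lambda>(r, s). if r = s then t r else 0) U U = prod_list (diag_mat ?M)"
    unfolding minor_def using assms
    by (intro det_upper_triangular[of _ "card U"] upper_triangularI)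
      (auto simp: sorted_list_of_set_nth_eq_iff)
  also have "\<dots> = (\<Prod>a = 0..<card U. t (?c a))"
    unfolding prod_list_diag_prod by (auto intro!: prod.cong)
  finally show ?thesis using prod_sorted_list_of_set_nth[OF assms] by simp
qed

lemma minor_eq_0_if_zero_row:
  assumes "finite I" "card I = card U" "finite U" "i \<in> I" "\<And>s. s \<in> U \<Longrightarrow> v (i, s) = 0"
  shows "minor v I U = 0"
proof -
  let ?m = "card U" and ?r = "\<lambda>a. sorted_list_of_set I ! a" and ?c = "\<lambda>b. sorted_list_of_set U ! b"
  obtain a where a: "a < ?m" "?r a = i"
    using assms(4) bij_betw_imp_surj_on[OF bij_betw_sorted_list_of_set[OF assms(1)]] assms(2)
    by (auto simp: image_iff set_eq_iff) (metis atLeastLessThan_iff)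
  have "(\<Prod>b = 0..<?m. mat ?m ?m (\<lambda>(a, b). v (?r a, ?c b)) $$ (b, \<pi> b)) = 0"
    if "\<pi> permutes {0..<?m}" for \<pi>
  proof (rule prod_zero)
    have "\<pi> a < ?m" using permutes_in_image[OF that, of a] a by simp
    then show "\<exists>b\<in>{0..<?m}. mat ?m ?m (\<lambda>(a, b). v (?r a, ?c b)) $$ (b, \<pi> b) = 0"
      using a assms(5) sorted_list_of_set_nth_in[OF assms(3)] by (intro bexI[of _ a]) auto
  qed simp
  then show ?thesis
    unfolding minor_def by (subst det_def'[OF mat_carrier]) (intro sum.neutral ballI, simp)
qed

lemma minor_eq_0_if_zero_col:
  assumes "finite I" "card I = card U" "finite U" "s \<in> U" "\<And>r. r \<in> I \<Longrightarrow> v (r, s) = 0"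
  shows "minor v I U = 0"
proof -
  have "minor v I U = minor (\<lambda>(r, s). v (s, r)) U I"
    unfolding minor_def assms(2)
    by (subst det_transpose[OF mat_carrier, symmetric]) (intro arg_cong[of _ _ det] eq_matI, auto)
  also have "\<dots> = 0" using assms by (intro minor_eq_0_if_zero_row[of U I s]) auto
  finally show ?thesis .
qed

text \<open>The submatrix is a permutation matrix \<open>M\<close>, so its transpose is an inverse and
  \<open>(det M)\<^sup>2 = 1\<close>.\<close>

lemma minor_permutation_nonzero:
  fixes v :: "nat \<times> nat \<Rightarrow> 'k::field"
  assumes fin: "finite U" and \<tau>: "bij_betw \<tau> U I"
    and v: "\<And>r s. r \<in> I \<Longrightarrow> s \<in> U \<Longrightarrow> v (r, s) = (if r = \<tau> s then 1 else 0)"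
  shows "minor v I U \<noteq> 0"
proof -
  let ?m = "card U" and ?r = "\<lambda>a. sorted_list_of_set I ! a" and ?c = "\<lambda>b. sorted_list_of_set U ! b"
  let ?M = "mat ?m ?m (\<lambda>(a, b). v (?r a, ?c b))"
  have card: "card I = ?m" using bij_betw_same_card[OF \<tau>] by simp
  have finI: "finite I" using bij_betw_finite[OF \<tau>] fin by simp
  have c: "?c b \<in> U" if "b < ?m" for b using sorted_list_of_set_nth_in[OF fin that] .
  have r: "?r a \<in> I" if "a < ?m" for a using sorted_list_of_set_nth_in[OF finI] that card by simp
  have orth: "(\<Sum>a = 0..<?m. v (?r a, ?c b) * v (?r a, ?c b')) = (if b = b' then 1 else 0)"
    if "b < ?m" "b' < ?m" for b b'
  proof -
    have "(\<Sum>a = 0..<?m. v (?r a, ?c b) * v (?r a, ?c b')) = (\<Sum>i\<in>I. v (i, ?c b) * v (i, ?c b'))"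
      using sum_sorted_list_of_set_nth[OF finI, of "\<lambda>i. v (i, ?c b) * v (i, ?c b')"] card by simp
    also have "\<dots> = (\<Sum>i\<in>I. if i = \<tau> (?c b) then (if \<tau> (?c b) = \<tau> (?c b') then 1 else 0) else 0)"
      using c that v by (intro sum.cong) auto
    also have "\<dots> = (if b = b' then 1 else 0)"
      using \<tau> c that finI sorted_list_of_set_nth_eq_iff[OF fin that]
      by (auto simp: bij_betw_def inj_on_eq_iff)
    finally show ?thesis .
  qed
  have "transpose_mat ?M * ?M = 1\<^sub>m ?m"
    using orth by (intro eq_matI) (auto simp: scalar_prod_def)
  then have "det (transpose_mat ?M) * det ?M = 1"
    by (metis det_mult det_one mat_carrier transpose_carrier_mat)
  then show ?thesis unfolding minor_def by auto
qed

lemma minor_elementary_nonzero: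
  fixes i j :: nat
  assumes "finite U" "j \<in> U" "i \<notin> U"
  shows "minor (\<lambda>(r, s). if r = s \<or> (r = i \<and> s = j) then 1 else 0 :: 'k::field) (insert i (U - {j})) U \<noteq> 0"
proof (rule minor_permutation_nonzero[where \<tau> = "\<lambda>s. if s = j then i else s"])
  show "bij_betw (\<lambda>s. if s = j then i else s) U (insert i (U - {j}))"
    using assms by (auto simp: bij_betw_def inj_on_def)
  show "(\<lambda>(r, s). if r = s \<or> (r = i \<and> s = j) then 1 else 0 :: 'k) (r, s) =
      (if r = (if s = j then i else s) then 1 else 0)" if "r \<in> insert i (U - {j})" "s \<in> U" for r s
    using that assms(3) by (cases "s = j"; cases "r = i") auto
qed fact

lemma minor_scale_columns:
  fixes v :: "nat \<times> nat \<Rightarrow> 'k::comm_ring_1"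
  assumes "finite I" "card I = card U" "U \<subseteq> {0..<n}"
  shows "minor (\<lambda>(r, s). v (r, s) * t s) I U = minor v I U * (\<Prod>i\<in>U. t i)"
proof -
  let ?d = "\<lambda>(r :: nat, s). if r = s then t r else 0"
  have finU: "finite U" using assms finite_subset by auto
  have "minor (\<lambda>(r, s). v (r, s) * t s) I U = minor (\<lambda>(r, s). \<Sum>l<n. v (r, l) * ?d (l, s)) I U"
    using assms by (intro minor_cong) (auto simp: finU if_distrib[of "(*) _"] cong: if_cong)
  also have "\<dots> = minor v I U * minor ?d U U" using assms by (intro minor_mult) auto
  finally show ?thesis by (simp add: minor_diagonal[OF finU])
qed

lemma minor_add_column:
  fixes v :: "nat \<times> nat \<Rightarrow> 'k::comm_ring_1"
  assumes I: "finite I" "card I = card U" and U: "U \<subseteq> {0..<n}"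
    and ij: "i \<noteq> j" "j \<in> U \<Longrightarrow> i \<in> U"
  shows "minor (\<lambda>(r, s). if s = j then v (r, j) + c * v (r, i) else v (r, s)) I U = minor v I U"
proof (cases "j \<in> U")
  case False
  then show ?thesis using I finite_subset[OF U] by (intro minor_cong) auto
next
  case True
  with ij have i: "i \<in> U" by simp
  have finU: "finite U" using U finite_subset by auto
  let ?h = "\<lambda>(r, s). (if r = s then 1 else 0) + (if r = i \<and> s = j then c else 0)"
  have "minor (\<lambda>(r, s). if s = j then v (r, j) + c * v (r, i) else v (r, s)) I U =
      minor (\<lambda>(r, s). \<Sum>l<n. v (r, l) * ?h (l, s)) I U"
    using I finU U i
    by (intro minor_cong)
      (auto simp: distrib_left sum.distrib if_distrib[of "(*) _"] mult.commute subset_iff cong: if_cong conj_cong)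
  also have "\<dots> = minor v I U * minor ?h U U" using I U i by (intro minor_mult) auto
  also have "minor ?h U U = 1"
  proof -
    let ?m = "card U" and ?c = "\<lambda>b. sorted_list_of_set U ! b"
    have "\<exists>a<?m. ?c a = x" if "x \<in> U" for x
      using that bij_betw_imp_surj_on[OF bij_betw_sorted_list_of_set[OF finU]]
      by (auto simp: set_eq_iff image_iff) (metis atLeastLessThan_iff)
    then obtain a b where ab: "a < ?m" "?c a = i" "b < ?m" "?c b = j" using i True by metis
    have "mat ?m ?m (\<lambda>(a, b). ?h (?c a, ?c b)) = addrow_mat ?m c a b"
      using ab by (intro eq_matI) (auto simp: sorted_list_of_set_nth_eq_iff[OF finU, symmetric])
    moreover have "a \<noteq> b" using ab ij by auto
    ultimately show ?thesis unfolding minor_def by (simp add: det_addrow_mat)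
  qed
  finally show ?thesis by simp
qed

lemma minor_add_columns:
  fixes v :: "nat \<times> nat \<Rightarrow> 'k::comm_ring_1"
  assumes I: "finite I" "card I = card U" and U: "U \<subseteq> {0..<n}"
    and K: "finite K" "j \<notin> K" "j \<in> U \<Longrightarrow> K \<subseteq> U"
  shows "minor (\<lambda>(r, s). if s = j then v (r, j) + (\<Sum>i\<in>K. c i * v (r, i)) else v (r, s)) I U = minor v I U"
  using K
proof (induction K rule: finite_induct)
  case empty
  then show ?case using I finite_subset[OF U] by (intro minor_cong) auto
next
  case (insert i K)
  let ?w = "\<lambda>(r, s). if s = j then v (r, j) + (\<Sum>i\<in>K. c i * v (r, i)) else v (r, s)"
  have "minor (\<lambda>(r, s). if s = j then v (r, j) + (\<Sum>i\<in>insert i K. c i * v (r, i)) else v (r, s)) I U =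
      minor (\<lambda>(r, s). if s = j then ?w (r, j) + c i * ?w (r, i) else ?w (r, s)) I U"
    using I finite_subset[OF U] insert by (intro minor_cong) (auto simp: algebra_simps)
  also have "\<dots> = minor ?w I U" using I U insert by (intro minor_add_column[of I U n i j ?w]) auto
  also have "\<dots> = minor v I U" using insert by auto
  finally show ?case .
qed

section \<open>Points of the orbit and of the toric closure\<close>

text \<open>The vector \<open>g \<cdot> (\<Sum>U\<in>\<sigma>. e\<^sub>U)\<close>, where \<open>v\<close> gives the entries of \<open>g\<close>.\<close>

definition orbit_point ::
  "nat \<Rightarrow> nat set set \<Rightarrow> nat set set \<Rightarrow> (nat \<times> nat \<Rightarrow> 'k::field) \<Rightarrow> nat set \<times> nat set \<Rightarrow> 'k" where
  "orbit_point n \<F> \<sigma> v = (\<lambda>(U, I) \<in> W_index n \<F>. if U \<in> \<sigma> then minor v I U else 0)"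

lemma W_indexD:
  assumes "(U, I) \<in> W_index n \<F>" "\<F> \<subseteq> Pow {0..<n}"
  shows "U \<in> \<F>" "U \<subseteq> {0..<n}" "I \<subseteq> {0..<n}" "card I = card U" "finite U" "finite I"
  using assms by (auto simp: W_index_def intro: finite_subset)

lemma wedge_eq_minor:
  fixes g :: "'k::comm_ring_1 mat"
  assumes g: "g \<in> carrier_mat n n" and J: "J \<subseteq> {0..<n}" and I: "I \<subseteq> {0..<n}" "card I = card J"
  shows "wedge (map (\<lambda>j. g *\<^sub>v unit_vec n j) (sorted_list_of_set J)) I = minor (\<lambda>rs. g $$ rs) I J"
proof -
  have fin: "finite I" "finite J" using J I finite_subset by auto
  have "sorted_list_of_set I ! a < n" "sorted_list_of_set J ! a < n" if "a < card J" for a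
    using sorted_list_of_set_nth_in[OF fin(1), of a] sorted_list_of_set_nth_in[OF fin(2), of a] that I J
    by auto
  then show ?thesis
    unfolding wedge_def minor_def using g
    by (intro arg_cong[of _ _ det] eq_matI) auto
qed

lemma W_act_diagonal:
  fixes g :: "'k::field mat"
  assumes \<F>: "\<F> \<subseteq> Pow {0..<n}" and g: "g \<in> carrier_mat n n"
    and w: "\<And>U I. (U, I) \<in> W_index n \<F> \<Longrightarrow> I \<noteq> U \<Longrightarrow> w (U, I) = 0"
  shows "W_act n \<F> g w = (\<lambda>(U, I) \<in> W_index n \<F>. w (U, U) * minor (\<lambda>rs. g $$ rs) I U)"
proof -
  have "ext_act n (card U) g (\<lambda>J. w (U, J)) I = w (U, U) * minor (\<lambda>rs. g $$ rs) I U"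
    if "(U, I) \<in> W_index n \<F>" for U I
  proof -
    have U: "U \<in> \<F>" "I \<subseteq> {0..<n}" "card I = card U" using that by (auto simp: W_index_def)
    let ?J = "{J. J \<subseteq> {0..<n} \<and> card J = card U}"
    have fin: "finite ?J" by (rule finite_subset[of _ "Pow {0..<n}"]) auto
    have "ext_act n (card U) g (\<lambda>J. w (U, J)) I = (\<Sum>J\<in>?J. w (U, J) * minor (\<lambda>rs. g $$ rs) I J)"
      unfolding ext_act_def using U by (intro sum.cong) (auto simp: wedge_eq_minor[OF g])
    also have "\<dots> = w (U, U) * minor (\<lambda>rs. g $$ rs) I U"
      using U \<F> w fin by (subst sum.remove[of _ U]) (auto simp: W_index_def intro!: sum.neutral)
    finally show ?thesis .
  qed
  then show ?thesis unfolding W_act_def by (intro restrict_ext) auto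
qed

lemma p_vec_eq:
  assumes "\<F> \<subseteq> Pow {0..<n}"
  shows "p_vec n \<F> = (\<lambda>(U, I) \<in> W_index n \<F>. if I = U then 1 else 0)"
  unfolding p_vec_def using assms
  by (intro restrict_ext) (auto simp: W_index_def wedge_basis_eq)

lemma W_act_p_vec:
  fixes g :: "'k::field mat"
  assumes \<F>: "\<F> \<subseteq> Pow {0..<n}" and g: "g \<in> carrier_mat n n"
  shows "W_act n \<F> g (p_vec n \<F>) = orbit_point n \<F> \<F> (\<lambda>rs. g $$ rs)"
proof -
  have "W_act n \<F> g (p_vec n \<F>) =
      (\<lambda>(U, I) \<in> W_index n \<F>. p_vec n \<F> (U, U) * minor (\<lambda>rs. g $$ rs) I U)"
    by (rule W_act_diagonal[OF \<F> g]) (simp add: p_vec_eq[OF \<F>])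
  also have "\<dots> = orbit_point n \<F> \<F> (\<lambda>rs. g $$ rs)"
    unfolding orbit_point_def p_vec_eq[OF \<F>] using \<F>
    by (intro restrict_ext) (auto simp: W_index_def)
  finally show ?thesis .
qed

lemma orbit_point_cong:
  assumes \<F>: "\<F> \<subseteq> Pow {0..<n}" and "\<And>r s. r < n \<Longrightarrow> s < n \<Longrightarrow> v (r, s) = w (r, s)"
  shows "orbit_point n \<F> \<sigma> v = orbit_point n \<F> \<sigma> w"
proof -
  have "minor v I U = minor w I U" if "(U, I) \<in> W_index n \<F>" for U I
    using W_indexD[OF that \<F>] assms(2) by (intro minor_cong) (auto simp: subset_iff)
  then show ?thesis unfolding orbit_point_def by (intro restrict_ext) auto
qed

lemma SL_orbit_eq:
  assumes \<F>: "\<F> \<subseteq> Pow {0..<n}"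
  shows "SL_orbit n \<F> = orbit_point n \<F> \<F> ` {v :: nat \<times> nat \<Rightarrow> 'k::field. det (mat n n v) = 1}"
proof (intro Set.set_eqI iffI)
  fix y :: "nat set \<times> nat set \<Rightarrow> 'k" assume "y \<in> SL_orbit n \<F>"
  then obtain g where g: "g \<in> carrier_mat n n" "det g = 1" "y = W_act n \<F> g (p_vec n \<F>)"
    by (auto simp: SL_orbit_def SL_def)
  have "mat n n (\<lambda>rs. g $$ rs) = g" using g by (intro eq_matI) auto
  then show "y \<in> orbit_point n \<F> \<F> ` {v. det (mat n n v) = 1}"
    using g W_act_p_vec[OF \<F> g(1)] by auto
next
  fix y :: "nat set \<times> nat set \<Rightarrow> 'k" assume "y \<in> orbit_point n \<F> \<F> ` {v. det (mat n n v) = 1}"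
  then obtain v where v: "det (mat n n v) = 1" "y = orbit_point n \<F> \<F> v" by auto
  have "y = W_act n \<F> (mat n n v) (p_vec n \<F>)"
    unfolding v(2) W_act_p_vec[OF \<F> mat_carrier] by (rule orbit_point_cong[OF \<F>]) auto
  then show "y \<in> SL_orbit n \<F>" using v(1) by (auto simp: SL_orbit_def SL_def)
qed

lemma torus_orbitE:
  assumes \<F>: "\<F> \<subseteq> Pow {0..<n}" and y: "y \<in> torus_orbit n \<F>"
  obtains \<tau> :: "nat \<Rightarrow> 'k::field" where "(\<Prod>i = 0..<n. \<tau> i) = 1"
    "y = (\<lambda>(U, I) \<in> W_index n \<F>. if I = U then \<Prod>i\<in>U. \<tau> i else 0)"
proof -
  obtain t where t: "t \<in> carrier_mat n n" "det t = 1" "diagonal_mat t" "y = W_act n \<F> t (p_vec n \<F>)"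
    using y by (auto simp: torus_orbit_def diag_torus_def SL_def)
  let ?\<tau> = "\<lambda>i. t $$ (i, i)"
  have "minor (\<lambda>rs. t $$ rs) I U = (if I = U then \<Prod>i\<in>U. ?\<tau> i else 0)" if "(U, I) \<in> W_index n \<F>" for U I
  proof -
    have UI: "U \<subseteq> {0..<n}" "I \<subseteq> {0..<n}" "card I = card U" "finite I" "finite U"
      using W_indexD[OF that \<F>] by auto
    show ?thesis
    proof (cases "I = U")
      case True
      have "minor (\<lambda>rs. t $$ rs) U U = minor (\<lambda>(r, s). if r = s then ?\<tau> r else 0) U U"
        using UI t(1,3) by (intro minor_cong) (auto simp: diagonal_mat_def subset_iff)
      then show ?thesis using True UI by (simp add: minor_diagonal)
    next
      case False
      then obtain i where "i \<in> I" "i \<notin> U" using UI by (metis card_subset_eq subsetI)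
      then show ?thesis using False UI t(1,3)
        by (auto intro!: minor_eq_0_if_zero_row[of I U i] simp: diagonal_mat_def subset_iff)
    qed
  qed
  then have "y = (\<lambda>(U, I) \<in> W_index n \<F>. if I = U then \<Prod>i\<in>U. ?\<tau> i else 0)"
    unfolding t(4) W_act_p_vec[OF \<F> t(1)] orbit_point_def
    by (intro restrict_ext) (auto simp: W_index_def)
  moreover have "(\<Prod>i = 0..<n. ?\<tau> i) = 1"
  proof -
    have "upper_triangular t" using t by (intro upper_triangularI) (auto simp: diagonal_mat_def)
    then show ?thesis using det_upper_triangular[of t n] t prod_list_diag_prod[of t] by auto
  qed
  ultimately show thesis by (rule that[rotated])
qed

lemma closure_of_polynomial_eq:
  fixes w :: "'i \<Rightarrow> 'k::field"
  assumes w: "w \<in> zariski A closure_of T" and T: "T \<subseteq> A \<rightarrow>\<^sub>E UNIV"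
    and FG: "F \<in> polynomial_functions A" "G \<in> polynomial_functions A" "\<And>y. y \<in> T \<Longrightarrow> F y = G y"
  shows "F w = G w"
proof -
  let ?L = "zero_locus A {\<lambda>v. F v - G v}"
  have "closedin (zariski A) ?L"
    unfolding closedin_zariski using polynomial_functions_diff[OF FG(1,2)] by blast
  moreover have "T \<subseteq> ?L" using T FG(3) by (auto simp: zero_locus_def)
  ultimately have "w \<in> ?L" using closure_of_minimal w by blast
  then show ?thesis by (simp add: zero_locus_def)
qed

section \<open>The family of unions\<close>

lemma closed_root_subsetD:
  assumes "closed_root_subset n S" "(i, j) \<in> S"
  shows "i < j" "j < n"
  using assms(1)[unfolded closed_root_subset_def, THEN conjunct1] assms(2)
  by (auto simp: pos_roots_def)

lemma union_family_iff:
  assumes S: "closed_root_subset n S"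
  shows "U \<in> union_family n S \<longleftrightarrow> U \<subseteq> {0..<n} \<and> U \<noteq> {} \<and> (\<forall>i j. (i, j) \<in> S \<and> j \<in> U \<longrightarrow> i \<in> U)"
    (is "_ = ?R")
proof
  assume "U \<in> union_family n S"
  then obtain J where J: "J \<subseteq> {0..<n}" "J \<noteq> {}" "U = (\<Union>j\<in>J. col_support S j)"
    unfolding union_family_def by blast
  have "col_support S j \<subseteq> {0..<n}" if "j < n" for j
    using that closed_root_subsetD[OF S] unfolding col_support_def by fastforce
  then have "U \<subseteq> {0..<n}" using J by (auto simp: subset_iff)
  moreover have "U \<noteq> {}" using J by (auto simp: col_support_def)
  moreover have "i \<in> U" if "(i, j) \<in> S" "j \<in> U" for i j
    using that S J(3) unfolding col_support_def closed_root_subset_def by blast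
  ultimately show ?R by blast
next
  assume R: ?R
  then have "U = (\<Union>j\<in>U. col_support S j)" by (auto simp: col_support_def)
  then show "U \<in> union_family n S" using R unfolding union_family_def by blast
qed

lemma union_family_subset_Pow: "closed_root_subset n S \<Longrightarrow> union_family n S \<subseteq> Pow {0..<n}"
  using union_family_iff by blast

lemma full_in_union_family: "closed_root_subset n S \<Longrightarrow> n \<ge> 1 \<Longrightarrow> {0..<n} \<in> union_family n S"
  by (subst union_family_iff) (auto dest: closed_root_subsetD)

section \<open>The toric boundary\<close>

text \<open>It is a member only if \<open>\<sigma>\<close> is closed under nonempty intersections, which holds in the
  case of interest, where \<open>\<sigma>\<close> is the support of a point of the closure of the torus orbit.\<close>

definition least_member :: "'a set set \<Rightarrow> 'a \<Rightarrow> 'a set" where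
  "least_member \<sigma> j = \<Inter>{U \<in> \<sigma>. j \<in> U}"

lemma in_least_member: "j \<in> least_member \<sigma> j"
  by (simp add: least_member_def)

lemma least_member_subset: "U \<in> \<sigma> \<Longrightarrow> j \<in> U \<Longrightarrow> least_member \<sigma> j \<subseteq> U"
  by (auto simp: least_member_def)

lemma least_member_mono: "i \<in> least_member \<sigma> j \<Longrightarrow> least_member \<sigma> i \<subseteq> least_member \<sigma> j"
  by (auto simp: least_member_def)

text \<open>The points of the torus orbit satisfy monomial equations, which persist in its closure.

  First, \<open>x\<^sub>U x\<^sub>V = x\<^bsub>U \<union> V\<^esub> x\<^bsub>U \<inter> V\<^esub>\<close>, where \<open>x\<^sub>U\<close> is the coordinate \<open>(U, U)\<close> and \<open>x\<^sub>\<emptyset> = 1\<close>.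
  So the support \<open>\<sigma>\<close> of a point \<open>w\<close> of the closure is closed under union and nonempty
  intersection. Let \<open>M\<^sub>j\<close> be its least member containing \<open>j\<close>, and \<open>C\<^sub>j\<close> the class of all \<open>i\<close> with
  \<open>M\<^sub>i = M\<^sub>j\<close>. As \<open>M\<^sub>j - C\<^sub>j\<close> is a union of smaller sets \<open>M\<^sub>i\<close>, it is empty or in \<open>\<sigma>\<close>.

  Second, if \<open>U\<close> is a union of classes, then on the torus orbit \<open>x\<^sub>U\<close> is the product, over these
  classes, of the quotients of \<open>x\<close> at \<open>M\<^sub>j\<close> and at \<open>M\<^sub>j - C\<^sub>j\<close>. So the torus element that has
  this quotient of \<open>w\<close> as its entry at one index of each class, and \<open>1\<close> elsewhere, agrees with
  \<open>w\<close> at all such \<open>U\<close>.\<close>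

lemma torus_closure_point:
  fixes w :: "nat set \<times> nat set \<Rightarrow> 'k::field"
  assumes S: "closed_root_subset n S" and n: "n \<ge> 1"
    and w: "w \<in> zariski (W_index n (union_family n S)) closure_of torus_orbit n (union_family n S)"
  defines "\<sigma> \<equiv> {U \<in> union_family n S. w (U, U) \<noteq> 0}"
  shows "{0..<n} \<in> \<sigma>"
    and "(U, I) \<in> W_index n (union_family n S) \<Longrightarrow> I \<noteq> U \<Longrightarrow> w (U, I) = 0"
    and "\<exists>t. (\<Prod>i = 0..<n. t i) = 1 \<and> (\<forall>U \<in> union_family n S.
      (\<forall>i<n. \<forall>j\<in>U. least_member \<sigma> i = least_member \<sigma> j \<longrightarrow> i \<in> U) \<longrightarrow> w (U, U) = (\<Prod>i\<in>U. t i))"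
proof -
  let ?F = "union_family n S"
  let ?T = "torus_orbit n ?F :: (nat set \<times> nat set \<Rightarrow> 'k) set"
  let ?P = "polynomial_functions (W_index n ?F) :: ((nat set \<times> nat set \<Rightarrow> 'k) \<Rightarrow> 'k) set"
  note Pow = union_family_subset_Pow[OF S]
  have TE: "?T \<subseteq> W_index n ?F \<rightarrow>\<^sub>E UNIV" by (auto simp: torus_orbit_def W_act_def)
  define x :: "nat set \<Rightarrow> (nat set \<times> nat set \<Rightarrow> 'k) \<Rightarrow> 'k"
    where "x U y = (if U = {} then 1 else y (U, U))" for U y
  let ?F' = "insert {} ?F"
  have x_poly: "x U \<in> ?P" if "U \<in> ?F'" for U
    using that Pow unfolding x_def
    by (cases "U = {}") (auto intro!: polynomial_functions.intros simp: W_index_def)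
  have torus: "\<exists>\<tau>. (\<Prod>i = 0..<n. \<tau> i) = 1 \<and> (\<forall>U\<in>?F'. x U y = (\<Prod>i\<in>U. \<tau> i)) \<and>
      (\<forall>U I. (U, I) \<in> W_index n ?F \<longrightarrow> I \<noteq> U \<longrightarrow> y (U, I) = 0)" if y: "y \<in> ?T" for y
  proof -
    obtain \<tau> where \<tau>: "(\<Prod>i = 0..<n. \<tau> i) = 1"
      "y = (\<lambda>(U, I) \<in> W_index n ?F. if I = U then \<Prod>i\<in>U. \<tau> i else 0)"
      by (rule torus_orbitE[OF Pow y])
    have "(U, U) \<in> W_index n ?F" if "U \<in> ?F" for U using that Pow by (auto simp: W_index_def)
    then show ?thesis using \<tau> by (intro exI[of _ \<tau>]) (auto simp: x_def)
  qed
  have F'_fin: "finite U" if "U \<in> ?F'" for U using that Pow by (auto intro: finite_subset)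
  have F'_iff: "U \<in> ?F' \<longleftrightarrow> U \<subseteq> {0..<n} \<and> (\<forall>i j. (i, j) \<in> S \<and> j \<in> U \<longrightarrow> i \<in> U)" for U
    using union_family_iff[OF S] by auto
  have F'_Un: "U \<union> V \<in> ?F'" and F'_Int: "U \<inter> V \<in> ?F'" if "U \<in> ?F'" "V \<in> ?F'" for U V
    using that unfolding F'_iff by blast+
  have full: "{0..<n} \<in> ?F" by (rule full_in_union_family[OF S n])
  have x_full: "x {0..<n} w = 1"
  proof (rule closure_of_polynomial_eq[OF w TE])
    show "x {0..<n} \<in> ?P" using full by (intro x_poly) simp
    show "x {0..<n} y = 1" if "y \<in> ?T" for y using torus[OF that] full by auto
  qed (rule polynomial_functions.const)
  then show full_\<sigma>: "{0..<n} \<in> \<sigma>" using full n by (simp add: \<sigma>_def x_def)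
  show "w (U, I) = 0" if "(U, I) \<in> W_index n ?F" "I \<noteq> U" for U I
  proof (rule closure_of_polynomial_eq[OF w TE, of "\<lambda>w. w (U, I)" "\<lambda>_. 0"])
    show "y (U, I) = 0" if "y \<in> ?T" for y using torus[OF that] \<open>(U, I) \<in> _\<close> \<open>I \<noteq> U\<close> by blast
  qed (use that in \<open>auto intro: polynomial_functions.intros\<close>)
  have x_Un_Int: "x U w * x V w = x (U \<union> V) w * x (U \<inter> V) w" if "U \<in> ?F'" "V \<in> ?F'" for U V
  proof (rule closure_of_polynomial_eq[OF w TE])
    show "(\<lambda>y. x U y * x V y) \<in> ?P" "(\<lambda>y. x (U \<union> V) y * x (U \<inter> V) y) \<in> ?P"
      by (intro polynomial_functions.mult x_poly F'_Un F'_Int that)+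
    fix y assume "y \<in> ?T"
    then obtain \<tau> where \<tau>: "\<And>U. U \<in> ?F' \<Longrightarrow> x U y = (\<Prod>i\<in>U. \<tau> i)" using torus by blast
    show "x U y * x V y = x (U \<union> V) y * x (U \<inter> V) y"
      unfolding \<tau>[OF that(1)] \<tau>[OF that(2)] \<tau>[OF F'_Un[OF that]] \<tau>[OF F'_Int[OF that]]
      by (rule prod.union_inter[symmetric]) (intro F'_fin that)+
  qed
  define \<sigma>' where "\<sigma>' = {U \<in> ?F'. x U w \<noteq> 0}"
  have \<sigma>': "\<sigma>' = insert {} \<sigma>"
    unfolding \<sigma>'_def \<sigma>_def x_def by (auto simp: union_family_iff[OF S])
  have \<sigma>'_Un: "U \<union> V \<in> \<sigma>'" and \<sigma>'_Int: "U \<inter> V \<in> \<sigma>'" if "U \<in> \<sigma>'" "V \<in> \<sigma>'" for U V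
  proof -
    have UV: "U \<in> ?F'" "V \<in> ?F'" "x U w \<noteq> 0" "x V w \<noteq> 0" using that unfolding \<sigma>'_def by blast+
    then have "x (U \<union> V) w * x (U \<inter> V) w \<noteq> 0" using x_Un_Int[OF UV(1,2)] by (metis mult_eq_0_iff)
    then show "U \<union> V \<in> \<sigma>'" "U \<inter> V \<in> \<sigma>'"
      using F'_Un[OF UV(1,2)] F'_Int[OF UV(1,2)] unfolding \<sigma>'_def by auto
  qed
  have \<sigma>'_Union: "\<Union>X \<in> \<sigma>'" if "finite X" "X \<subseteq> \<sigma>'" for X
    using that by (induction X rule: finite_induct) (auto simp: \<sigma>'_Un, simp add: \<sigma>')
  have \<sigma>'_Inter: "\<Inter>X \<in> \<sigma>'" if "finite X" "X \<noteq> {}" "X \<subseteq> \<sigma>'" for X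
    using that by (induction X rule: finite_ne_induct) (auto simp: \<sigma>'_Int)
  let ?M = "least_member \<sigma>"
  have fin_\<sigma>: "finite \<sigma>"
    by (rule finite_subset[of _ "Pow {0..<n}"]) (use Pow in \<open>auto simp: \<sigma>_def\<close>)
  have M_\<sigma>': "?M j \<in> \<sigma>'" if "j < n" for j
    unfolding least_member_def
  proof (rule \<sigma>'_Inter)
    show "finite {U \<in> \<sigma>. j \<in> U}" using fin_\<sigma> by simp
    have "{0..<n} \<in> {U \<in> \<sigma>. j \<in> U}" using full_\<sigma> that by simp
    then show "{U \<in> \<sigma>. j \<in> U} \<noteq> {}" by (intro notI) (simp only: empty_iff)
    show "{U \<in> \<sigma>. j \<in> U} \<subseteq> \<sigma>'" unfolding \<sigma>' by blast
  qed
  have M_sub: "?M j \<subseteq> {0..<n}" if "j < n" for j using least_member_subset[OF full_\<sigma>] that by simp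
  define C where "C j = {i \<in> {0..<n}. ?M i = ?M j}" for j
  define D where "D j = ?M j - C j" for j
  have C_M: "C j \<subseteq> ?M j" for j
  proof
    fix i assume "i \<in> C j"
    then show "i \<in> ?M j" using in_least_member[of i \<sigma>] by (simp add: C_def)
  qed
  have D_\<sigma>': "D j \<in> \<sigma>'" if j: "j < n" for j
  proof -
    have "?M i \<subseteq> D j" if i: "i \<in> D j" for i
    proof
      fix l assume l: "l \<in> ?M i"
      have iM: "i \<in> ?M j" "i \<notin> C j" using i by (auto simp: D_def)
      have ij: "?M i \<subseteq> ?M j" by (rule least_member_mono[OF iM(1)])
      have "l \<notin> C j"
      proof
        assume "l \<in> C j"
        then have "?M j \<subseteq> ?M i" using least_member_mono[OF l] by (simp add: C_def)
        then have "?M i = ?M j" using ij by (rule equalityI[rotated])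
        moreover have "i \<in> {0..<n}" using iM(1) M_sub[OF j] by (rule subsetD[rotated])
        ultimately show False using iM(2) by (simp add: C_def)
      qed
      then show "l \<in> D j" using ij l by (auto simp: D_def)
    qed
    then have "\<Union>(?M ` D j) \<subseteq> D j" by (rule UN_least)
    moreover have "D j \<subseteq> \<Union>(?M ` D j)" using in_least_member[of _ \<sigma>] by (intro subsetI UN_I)
    ultimately have "D j = \<Union>(?M ` D j)" by (rule equalityI[rotated])
    moreover have "\<Union>(?M ` D j) \<in> \<sigma>'"
    proof (rule \<sigma>'_Union)
      have "D j \<subseteq> {0..<n}" using M_sub[OF j] by (auto simp: D_def)
      then show "finite (?M ` D j)" "?M ` D j \<subseteq> \<sigma>'" using M_\<sigma>' by (auto intro: finite_subset)
    qed
    ultimately show ?thesis by simp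
  qed
  \<comment> \<open>One index of each class \<open>C j\<close> carries the whole quotient.\<close>
  define \<rho> where "\<rho> j = (LEAST i. i < n \<and> ?M i = ?M j)" for j
  have \<rho>: "\<rho> j < n \<and> ?M (\<rho> j) = ?M j" if "j < n" for j
    unfolding \<rho>_def by (rule LeastI[of "\<lambda>i. i < n \<and> ?M i = ?M j" j]) (use that in simp)
  have \<rho>_eq: "\<rho> i = \<rho> j" if "?M i = ?M j" for i j using that by (simp add: \<rho>_def)
  define R where "R = {j. j < n \<and> \<rho> j = j}"
  define t where "t j = (if j \<in> R then x (?M j) w / x (D j) w else 1)" for j
  have main: "x U w = (\<Prod>i\<in>U. t i)"
    if U: "U \<in> ?F" and sat: "\<forall>i<n. \<forall>j\<in>U. ?M i = ?M j \<longrightarrow> i \<in> U" for U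
  proof -
    have Un: "U \<subseteq> {0..<n}" and finU: "finite U" using U Pow F'_fin by auto
    have "x U w * (\<Prod>j\<in>U \<inter> R. x (D j) w) = (\<Prod>j\<in>U \<inter> R. x (?M j) w)"
    proof (rule closure_of_polynomial_eq[OF w TE])
      have R: "?M j \<in> ?F'" "D j \<in> ?F'" if "j \<in> R" for j
        using M_\<sigma>'[of j] D_\<sigma>'[of j] that by (simp_all only: \<sigma>'_def R_def mem_Collect_eq)
      show "(\<lambda>y. x U y * (\<Prod>j\<in>U \<inter> R. x (D j) y)) \<in> ?P"
        by (intro polynomial_functions.mult polynomial_functions_prod x_poly insertI2[OF U]) (erule IntE, erule R(2))
      show "(\<lambda>y. \<Prod>j\<in>U \<inter> R. x (?M j) y) \<in> ?P"
        by (intro polynomial_functions_prod x_poly) (erule IntE, erule R(1))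
      fix y assume "y \<in> ?T"
      then obtain \<tau> where \<tau>: "\<And>U. U \<in> ?F' \<Longrightarrow> x U y = (\<Prod>i\<in>U. \<tau> i)" using torus by blast
      have fibre: "{i \<in> U. \<rho> i = j} = C j" if "j \<in> U \<inter> R" for j
      proof (intro equalityI subsetI)
        fix i assume "i \<in> {i \<in> U. \<rho> i = j}"
        then show "i \<in> C j" using \<rho>[of i] Un by (auto simp: C_def)
      next
        fix i assume "i \<in> C j"
        then have "i < n" "?M i = ?M j" by (simp_all add: C_def)
        then show "i \<in> {i \<in> U. \<rho> i = j}"
          using that sat[rule_format, of i j] \<rho>_eq[of i j] by (simp add: R_def)
      qed
      have "\<rho> ` U \<subseteq> U \<inter> R"
      proof (rule image_subsetI)
        fix i assume i: "i \<in> U"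
        then have "\<rho> i < n" "?M (\<rho> i) = ?M i" using \<rho>[of i] Un by auto
        then show "\<rho> i \<in> U \<inter> R"
          using sat[rule_format, of "\<rho> i" i] i \<rho>_eq[of "\<rho> i" i] by (simp add: R_def)
      qed
      then have "(\<Prod>i\<in>U. \<tau> i) = (\<Prod>j\<in>U \<inter> R. \<Prod>i | i \<in> U \<and> \<rho> i = j. \<tau> i)"
        using finU by (intro prod.group[symmetric]) auto
      also have "\<dots> = (\<Prod>j\<in>U \<inter> R. \<Prod>i\<in>C j. \<tau> i)" using fibre by (intro prod.cong) auto
      finally have "x U y = (\<Prod>j\<in>U \<inter> R. \<Prod>i\<in>C j. \<tau> i)" using \<tau>[OF insertI2[OF U]] by simp
      moreover have "(\<Prod>j\<in>U \<inter> R. x (D j) y) = (\<Prod>j\<in>U \<inter> R. \<Prod>i\<in>D j. \<tau> i)"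
        by (rule prod.cong[OF refl]) (use R(2) \<tau> in blast)
      ultimately have "x U y * (\<Prod>j\<in>U \<inter> R. x (D j) y) =
          (\<Prod>j\<in>U \<inter> R. (\<Prod>i\<in>C j. \<tau> i) * (\<Prod>i\<in>D j. \<tau> i))"
        by (simp only: prod.distrib)
      also have "\<dots> = (\<Prod>j\<in>U \<inter> R. x (?M j) y)"
      proof (rule prod.cong[OF refl])
        fix j assume j: "j \<in> U \<inter> R"
        then have "x (?M j) y = (\<Prod>i\<in>?M j. \<tau> i)" by (intro \<tau> R(1)) simp
        also have "\<dots> = (\<Prod>i\<in>D j. \<tau> i) * (\<Prod>i\<in>C j. \<tau> i)"
          unfolding D_def using j by (intro prod.subset_diff[OF C_M F'_fin[OF R(1)]]) simp
        finally show "(\<Prod>i\<in>C j. \<tau> i) * (\<Prod>i\<in>D j. \<tau> i) = x (?M j) y" by (simp add: mult.commute)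
      qed
      finally show "x U y * (\<Prod>j\<in>U \<inter> R. x (D j) y) = (\<Prod>j\<in>U \<inter> R. x (?M j) y)" .
    qed
    moreover have "(\<Prod>j\<in>U \<inter> R. x (D j) w) \<noteq> 0"
      using D_\<sigma>' finU by (simp add: \<sigma>'_def R_def del: insert_iff)
    ultimately have "x U w = (\<Prod>j\<in>U \<inter> R. x (?M j) w / x (D j) w)"
      by (simp add: prod_dividef field_simps)
    also have "\<dots> = (\<Prod>i\<in>U. t i)"
      unfolding t_def using finU by (intro prod.inter_restrict)
    finally show ?thesis .
  qed
  have "(\<Prod>i = 0..<n. t i) = 1" using main[OF full] x_full by auto
  moreover have "w (U, U) = (\<Prod>i\<in>U. t i)"
    if "U \<in> ?F" "\<forall>i<n. \<forall>j\<in>U. ?M i = ?M j \<longrightarrow> i \<in> U" for U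
    using main[OF that] that(1) by (simp add: x_def union_family_iff[OF S])
  ultimately show "\<exists>t. (\<Prod>i = 0..<n. t i) = 1 \<and> (\<forall>U \<in> ?F.
      (\<forall>i<n. \<forall>j\<in>U. ?M i = ?M j \<longrightarrow> i \<in> U) \<longrightarrow> w (U, U) = (\<Prod>i\<in>U. t i))"
    by blast
qed

text \<open>If the least members containing \<open>j\<close> are distinct for distinct \<open>j\<close>, then every \<open>U\<close> is a union
  of classes and \<open>w\<close> lies in the torus orbit. So at a boundary point two of them coincide. As the
  members of \<open>\<sigma>\<close> are unions of classes, the point is in the orbit of \<open>\<Sum>U\<in>\<sigma>. e\<^sub>U\<close>.\<close>

lemma toric_boundary_subset:
  assumes S: "closed_root_subset n S" and n: "n \<ge> 1"
  defines "\<F> \<equiv> union_family n S"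
  shows "toric_closure n \<F> - SL_orbit n \<F> \<subseteq>
    (\<Union>\<sigma> \<in> {\<sigma>. \<sigma> \<subseteq> \<F> \<and> {0..<n} \<in> \<sigma> \<and> (\<exists>c<n. \<exists>d<n. c \<noteq> d \<and> least_member \<sigma> c = least_member \<sigma> d)}.
      orbit_point n \<F> \<sigma> ` {v :: nat \<times> nat \<Rightarrow> 'k::field. det (mat n n v) = 1})"
proof
  fix y :: "nat set \<times> nat set \<Rightarrow> 'k" assume y: "y \<in> toric_closure n \<F> - SL_orbit n \<F>"
  have Pow: "\<F> \<subseteq> Pow {0..<n}" unfolding \<F>_def by (rule union_family_subset_Pow[OF S])
  obtain g w where g: "g \<in> carrier_mat n n" "det g = 1"
    and w: "w \<in> zariski (W_index n \<F>) closure_of torus_orbit n \<F>" and y_eq: "y = W_act n \<F> g w"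
    using y by (auto simp: toric_closure_def SL_def)
  define \<sigma> where "\<sigma> = {U \<in> \<F>. w (U, U) \<noteq> 0}"
  note point = torus_closure_point[OF S n, folded \<F>_def, OF w, folded \<sigma>_def]
  obtain t where t: "(\<Prod>i = 0..<n. t i) = 1"
    and wt: "\<And>U. U \<in> \<F> \<Longrightarrow> \<forall>i<n. \<forall>j\<in>U. least_member \<sigma> i = least_member \<sigma> j \<longrightarrow> i \<in> U \<Longrightarrow> w (U, U) = (\<Prod>i\<in>U. t i)"
    using point(3) by blast
  define v where "v = (\<lambda>(r, s). g $$ (r, s) * t s)"
  have minor_v: "minor v I U = minor (\<lambda>rs. g $$ rs) I U * (\<Prod>i\<in>U. t i)" if "(U, I) \<in> W_index n \<F>" for U I
    unfolding v_def using W_indexD[OF that Pow]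
    by (intro minor_scale_columns[where v = "\<lambda>rs. g $$ rs"]) auto
  have "mat n n (\<lambda>rs. g $$ rs) = g" using g by (intro eq_matI) auto
  then have "det (mat n n v) = 1"
    using minor_v[of "{0..<n}" "{0..<n}"] point(1) g t
    unfolding minor_full_eq_det by (auto simp: W_index_def \<sigma>_def)
  have y_minor: "y = (\<lambda>(U, I) \<in> W_index n \<F>. w (U, U) * minor (\<lambda>rs. g $$ rs) I U)"
    unfolding y_eq by (rule W_act_diagonal[OF Pow g(1)]) (rule point(2))
  have \<sigma>_sat: "\<forall>i<n. \<forall>j\<in>U. least_member \<sigma> i = least_member \<sigma> j \<longrightarrow> i \<in> U" if "U \<in> \<sigma>" for U
    using least_member_subset[OF that] in_least_member[of _ \<sigma>] by (metis subsetD)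
  have y_\<sigma>: "y = orbit_point n \<F> \<sigma> v"
    unfolding y_minor orbit_point_def
  proof (intro restrict_ext, clarify)
    fix U I assume UI: "(U, I) \<in> W_index n \<F>"
    then have U: "U \<in> \<F>" by (simp add: W_index_def)
    show "w (U, U) * minor (\<lambda>rs. g $$ rs) I U = (if U \<in> \<sigma> then minor v I U else 0)"
    proof (cases "U \<in> \<sigma>")
      case True
      then show ?thesis using minor_v[OF UI] wt[OF U \<sigma>_sat] by simp
    next
      case False
      then have "w (U, U) = 0" using U by (simp add: \<sigma>_def)
      then show ?thesis using False by simp
    qed
  qed
  have "\<exists>c<n. \<exists>d<n. c \<noteq> d \<and> least_member \<sigma> c = least_member \<sigma> d"
  proof (rule ccontr)
    assume distinct: "\<not> ?thesis"
    have "y = orbit_point n \<F> \<F> v"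
      unfolding y_minor orbit_point_def
    proof (intro restrict_ext, clarify)
      fix U I assume UI: "(U, I) \<in> W_index n \<F>"
      then have U: "U \<in> \<F>" by (simp add: W_index_def)
      have "w (U, U) = (\<Prod>i\<in>U. t i)" 
      proof (rule wt[OF U], intro allI impI ballI)
        fix i j assume "i < n" "j \<in> U" "least_member \<sigma> i = least_member \<sigma> j"
        moreover have "j < n" using subsetD[OF Pow U] \<open>j \<in> U\<close> by auto
        ultimately show "i \<in> U" using distinct by metis
      qed
      then show "w (U, U) * minor (\<lambda>rs. g $$ rs) I U = (if U \<in> \<F> then minor v I U else 0)"
        using minor_v[OF UI] U by simp
    qed
    then have "y \<in> SL_orbit n \<F>" unfolding SL_orbit_eq[OF Pow] using \<open>det (mat n n v) = 1\<close> by blast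
    then show False using y by simp
  qed
  with point(1) show "y \<in> (\<Union>\<sigma> \<in> {\<sigma>. \<sigma> \<subseteq> \<F> \<and> {0..<n} \<in> \<sigma> \<and> (\<exists>c<n. \<exists>d<n. c \<noteq> d \<and> least_member \<sigma> c = least_member \<sigma> d)}.
      orbit_point n \<F> \<sigma> ` {v. det (mat n n v) = 1})"
  proof (intro UN_I[of \<sigma>] CollectI conjI)
    show "\<sigma> \<subseteq> \<F>" by (auto simp: \<sigma>_def)
    show "y \<in> orbit_point n \<F> \<sigma> ` {v. det (mat n n v) = 1}"
      using y_\<sigma> \<open>det (mat n n v) = 1\<close> by blast
  qed
qed

section \<open>Orbits with coinciding least members\<close>

text \<open>Completing the block by the identity turns a linear system with rows and columns in \<open>K\<close> into
  one with an \<open>n \<times> n\<close> matrix, so that no enumeration of \<open>K\<close> is needed.\<close>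

definition block :: "nat set \<Rightarrow> (nat \<times> nat \<Rightarrow> 'k) \<Rightarrow> nat \<times> nat \<Rightarrow> 'k::comm_ring_1" where
  "block K v = (\<lambda>(r, s). if r \<in> K \<and> s \<in> K then v (r, s) else if r = s then 1 else 0)"

lemma det_block_in_polynomial_functions:
  "(\<lambda>v. det (mat n n (block K v))) \<in> polynomial_functions ({0..<n} \<times> {0..<n})"
proof -
  let ?A = "{0..<n} \<times> {0..<n}"
  have "(\<lambda>v. block K v rs :: 'a) \<in> polynomial_functions ?A" if "rs \<in> ?A" for rs
    using that unfolding block_def
    by (cases rs, cases "fst rs \<in> K \<and> snd rs \<in> K") (auto intro: polynomial_functions.intros)
  from polynomial_functions_compose[OF minor_in_polynomial_functions[of "{0..<n}" n "{0..<n}"] this]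
  show ?thesis unfolding minor_full_eq_det by simp
qed

lemma det_block_identity:
  "det (mat n n (block K (\<lambda>(r, s). if r = s then 1 else 0))) = (1 :: 'k::comm_ring_1)"
proof -
  have "mat n n (block K (\<lambda>(r, s). if r = s then 1 else 0)) = (1\<^sub>m n :: 'k mat)"
    by (intro eq_matI) (auto simp: block_def)
  then show ?thesis by simp
qed

lemma block_inverse:
  fixes v :: "nat \<times> nat \<Rightarrow> 'k::field"
  assumes K: "K \<subseteq> {0..<n}" and det: "det (mat n n (block K v)) \<noteq> 0"
  shows "\<exists>B :: nat \<Rightarrow> nat \<Rightarrow> 'k.
    (\<forall>r\<in>K. \<forall>s\<in>K. (\<Sum>i\<in>K. v (r, i) * B i s) = (if r = s then 1 else 0)) \<and>
    (\<forall>i\<in>K. \<forall>l\<in>K. (\<Sum>s\<in>K. B i s * v (s, l)) = (if i = l then 1 else 0))"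
proof -
  let ?E = "mat n n (block K v)"
  let ?B = "\<lambda>i s. adj_mat ?E $$ (i, s) / det ?E"
  have E: "?E \<in> carrier_mat n n" by simp
  note adj = adj_mat[OF E]
  have adj_dim: "dim_row (adj_mat ?E) = n" "dim_col (adj_mat ?E) = n" using adj(1) by auto
  have right: "(\<Sum>i\<in>K. v (r, i) * ?B i s) = (if r = s then 1 else 0)" if "r \<in> K" "s \<in> K" for r s
  proof -
    have rs: "r < n" "s < n" using that K by auto
    have "(\<Sum>i\<in>K. v (r, i) * adj_mat ?E $$ (i, s)) = (\<Sum>i\<in>{0..<n}. ?E $$ (r, i) * adj_mat ?E $$ (i, s))"
      using K that rs by (intro sum.mono_neutral_cong_left) (auto simp: block_def)
    also have "\<dots> = (?E * adj_mat ?E) $$ (r, s)"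
      using rs adj_dim by (simp add: scalar_prod_def)
    also have "\<dots> = (if r = s then det ?E else 0)" unfolding adj(2) using rs by simp
    finally show ?thesis using det by (simp add: sum_divide_distrib[symmetric])
  qed
  have left: "(\<Sum>s\<in>K. ?B i s * v (s, l)) = (if i = l then 1 else 0)" if "i \<in> K" "l \<in> K" for i l
  proof -
    have il: "i < n" "l < n" using that K by auto
    have "(\<Sum>s\<in>K. adj_mat ?E $$ (i, s) * v (s, l)) = (\<Sum>s\<in>{0..<n}. adj_mat ?E $$ (i, s) * ?E $$ (s, l))"
      using K that il by (intro sum.mono_neutral_cong_left) (auto simp: block_def)
    also have "\<dots> = (adj_mat ?E * ?E) $$ (i, l)"
      using il adj_dim by (simp add: scalar_prod_def)
    also have "\<dots> = (if i = l then det ?E else 0)" unfolding adj(3) using il by simp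
    finally show ?thesis using det by (simp add: sum_divide_distrib[symmetric])
  qed
  show ?thesis by (intro exI[of _ ?B] conjI ballI right left)
qed

lemma alg_indep_on_image: "alg_indep_on J f (h ` Y) \<longleftrightarrow> alg_indep_on J (\<lambda>j y. f j (h y)) Y"
  by (simp add: alg_indep_on_def)

lemma orbit_point_in_polynomial_functions:
  assumes "\<F> \<subseteq> Pow {0..<n}" "q \<in> W_index n \<F>"
  shows "(\<lambda>v. orbit_point n \<F> \<sigma> v q) \<in> polynomial_functions ({0..<n} \<times> {0..<n})"
proof (cases q)
  case (Pair U I)
  then have UI: "(U, I) \<in> W_index n \<F>" using assms by simp
  show ?thesis
    using W_indexD[OF UI assms(1)] UI unfolding orbit_point_def Pair
    by (cases "U \<in> \<sigma>") (auto intro: minor_in_polynomial_functions polynomial_functions.const)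
qed

text \<open>Let \<open>M j\<close> be the least member of \<open>\<sigma>\<close> containing \<open>j\<close>. The orbit point
  of \<open>v\<close> does not change if multiples of the columns \<open>i \<in> M j\<close>, \<open>i \<noteq> j\<close>, are added to column \<open>j\<close>, nor, when \<open>M c = M d\<close>, if column \<open>c\<close> is scaled by
  \<open>h\<close> and column \<open>d\<close> by \<open>1/h\<close>. So the invariant functions \<open>f\<close> remain independent together with
  \<open>det - 1\<close> (which vanishes on \<open>SL\<^sub>n\<close>) and with the entries \<open>v (r, j)\<close>, \<open>r \<in> M j\<close>, \<open>r \<noteq> j\<close>, to which
  \<open>v (c, c)\<close> can be added because of the scaling. There are only \<open>n\<^sup>2\<close> independent functions.

  Column \<open>c\<close> has to come first: the moves that make its entries arbitrary also change column \<open>d\<close>.\<close>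

lemma degenerate_orbit_bound:
  fixes f :: "nat + nat \<times> nat \<Rightarrow> (nat set \<times> nat set \<Rightarrow> 'k::field) \<Rightarrow> 'k"
  assumes inf: "infinite (UNIV :: 'k set)" and \<F>: "\<F> \<subseteq> Pow {0..<n}"
    and \<sigma>: "\<sigma> \<subseteq> \<F>" "{0..<n} \<in> \<sigma>" and cd: "c < n" "d < n" "c \<noteq> d" "least_member \<sigma> c = least_member \<sigma> d"
    and f: "\<And>i. i < m \<Longrightarrow> f (Inl i) \<in> polynomial_functions (W_index n \<F>)"
    and ind: "alg_indep_on (Inl ` {..<m}) f (orbit_point n \<F> \<sigma> ` {v. det (mat n n v) = 1})"
  shows "m + card {(i, j). j < n \<and> i \<in> least_member \<sigma> j \<and> i \<noteq> j} + 2 \<le> n * n"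
proof -
  let ?A = "{0..<n} \<times> {0..<n}" and ?M = "least_member \<sigma>"
  have M: "?M j \<subseteq> {0..<n}" if "j < n" for j using least_member_subset[OF \<sigma>(2)] that by simp
  have finM: "finite (?M j)" if "j < n" for j using M[OF that] finite_subset by auto
  define G where "G k = (case k of
      Inl i \<Rightarrow> if i < m then (\<lambda>v. f (Inl i) (orbit_point n \<F> \<sigma> v)) else (\<lambda>v. det (mat n n v) - 1)
    | Inr q \<Rightarrow> (\<lambda>v :: nat \<times> nat \<Rightarrow> 'k. v q))" for k
  have G_inv: "G (Inl i) v' = G (Inl i) v"
    if "\<And>U I. U \<in> \<sigma> \<Longrightarrow> I \<subseteq> {0..<n} \<Longrightarrow> card I = card U \<Longrightarrow> minor v' I U = minor v I U" for v v' i
  proof -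
    have "orbit_point n \<F> \<sigma> v' = orbit_point n \<F> \<sigma> v"
      unfolding orbit_point_def
    proof (intro restrict_ext, clarify)
      fix U I assume "(U, I) \<in> W_index n \<F>"
      then show "(if U \<in> \<sigma> then minor v' I U else 0) = (if U \<in> \<sigma> then minor v I U else 0)"
        using that[of U I] by (simp add: W_index_def)
    qed
    moreover have "det (mat n n v') = det (mat n n v)"
      using that[OF \<sigma>(2), of "{0..<n}"] by (simp add: minor_full_eq_det)
    ultimately show ?thesis by (simp add: G_def)
  qed
  have G_Inl: "G (Inl i) \<in> polynomial_functions ?A" for i
  proof (cases "i < m")
    case True
    show ?thesis
      using polynomial_functions_compose[OF f[OF True] orbit_point_in_polynomial_functions[OF \<F>]] True
      by (simp add: G_def)
  next
    case False
    have "(\<lambda>v. minor v {0..<n} {0..<n} - 1 :: 'k) \<in> polynomial_functions ?A"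
      by (intro polynomial_functions_diff minor_in_polynomial_functions polynomial_functions.const) auto
    then show ?thesis using False by (simp add: G_def minor_full_eq_det)
  qed
  have G_Inr: "G (Inr q) \<in> polynomial_functions ?A" if "q \<in> ?A" for q
    using that by (auto simp: G_def intro: polynomial_functions.coord)
  let ?Jf = "Inl ` {..m} :: (nat + nat \<times> nat) set"
  let ?Jc = "Inr ` (?M c \<times> {c}) :: (nat + nat \<times> nat) set"
  let ?Jcols = "\<lambda>X. Inr ` {(r, j). j \<in> X \<and> r \<in> ?M j - {j}} :: (nat + nat \<times> nat) set"

  have ind0: "alg_indep_on ?Jf G UNIV"
  proof -
    have "alg_indep_on (insert (Inl m) (Inl ` {..<m})) G UNIV"
    proof (rule alg_indep_on_insert)
      show "alg_indep_on (Inl ` {..<m}) G {v. det (mat n n v) = 1}"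
        by (rule alg_indep_on_cong[OF ind[unfolded alg_indep_on_image]]) (auto simp: G_def)
      show "\<exists>v\<in>UNIV. G (Inl m) v \<noteq> 0"
      proof
        have "minor (\<lambda>_. 0 :: 'k) {0..<n} {0..<n} = 0"
          using cd(1) by (intro minor_eq_0_if_zero_row[of _ _ 0]) auto
        then show "G (Inl m) (\<lambda>_. 0) \<noteq> 0" by (simp add: G_def minor_full_eq_det)
      qed simp
      show "(\<forall>v\<in>UNIV. F v = 0) \<or> (\<forall>v\<in>UNIV. H v = 0)"
        if "F \<in> polynomial_functions ?A" "H \<in> polynomial_functions ?A" "\<forall>v\<in>UNIV. F v * H v = 0"
        for F H :: "(nat \<times> nat \<Rightarrow> 'k) \<Rightarrow> 'k"
        using polynomial_functions_mult_eq_0[OF inf that(1,2)] that(3) by blast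
    qed (auto simp: G_Inl, auto simp: G_def)
    moreover have "insert (Inl m) (Inl ` {..<m}) = ?Jf" by (auto simp: lessThan_Suc_atMost[symmetric])
    ultimately show ?thesis by simp
  qed

  have indc: "alg_indep_on (?Jf \<union> ?Jc) G UNIV"
  proof (rule alg_indep_on_Un[OF inf ind0, where z = "\<lambda>v. det (mat n n (block (?M c) v))"
        and y\<^sub>0 = "\<lambda>(r, s). if r = s then 1 else 0"])
    show "(\<lambda>v. det (mat n n (block (?M c) v))) \<in> polynomial_functions ?A"
      by (rule det_block_in_polynomial_functions)
    show "det (mat n n (block (?M c) (\<lambda>(r, s). if r = s then 1 else 0))) \<noteq> (0 :: 'k)"
      by (simp add: det_block_identity)
    fix v :: "nat \<times> nat \<Rightarrow> 'k" assume nz: "det (mat n n (block (?M c) v)) \<noteq> 0"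
    from block_inverse[OF M[OF cd(1)] nz] obtain B where
      B: "\<forall>r\<in>?M c. \<forall>s\<in>?M c. (\<Sum>i\<in>?M c. v (r, i) * B i s) = (if r = s then 1 else 0)"
        "\<forall>i\<in>?M c. \<forall>l\<in>?M c. (\<Sum>s\<in>?M c. B i s * v (s, l)) = (if i = l then 1 else 0)"
      by (elim exE conjE)
    let ?h = "\<lambda>(u :: nat + nat \<times> nat \<Rightarrow> 'k) i. \<Sum>s\<in>?M c. B i s * u (Inr (s, c))"
    \<comment> \<open>All entries of column \<open>c\<close> in the rows \<open>M c\<close> can be reached, except those that need a zero
      coefficient of column \<open>c\<close> itself: column \<open>d\<close> has to be divided by this coefficient.\<close>
    show "\<exists>l\<in>polynomial_functions ?Jc. (\<exists>u. l u \<noteq> 0) \<and> (\<forall>u. l u \<noteq> 0 \<longrightarrow>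
        (\<exists>v'. (\<forall>j\<in>?Jf. G j v' = G j v) \<and> (\<forall>j\<in>?Jc. G j v' = u j)))"
    proof (intro bexI conjI allI impI)
      show "(\<lambda>u. ?h u c) \<in> polynomial_functions ?Jc"
        by (intro polynomial_functions_sum polynomial_functions.mult polynomial_functions.const
            polynomial_functions.coord) auto
      show "\<exists>u. ?h u c \<noteq> 0"
        by (rule exI[of _ "case_sum (\<lambda>_. 0) v"]) (simp add: B(2) in_least_member)
      fix u assume hc: "?h u c \<noteq> 0"
      define h where "h = ?h u"
      let ?t = "\<lambda>s. (if s = c then h c else 1) * (if s = d then 1 / h c else 1)"
      let ?v\<^sub>1 = "\<lambda>(r, s). v (r, s) * ?t s"
      \<comment> \<open>Column \<open>d\<close> has been divided by \<open>h c\<close> when it is added to column \<open>c\<close>.\<close>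
      let ?h' = "\<lambda>i. if i = d then h d * h c else h i"
      let ?v' = "\<lambda>(r, s). if s = c then ?v\<^sub>1 (r, c) + (\<Sum>i\<in>?M c - {c}. ?h' i * ?v\<^sub>1 (r, i)) else ?v\<^sub>1 (r, s)"
      have h0: "h c \<noteq> 0" using hc by (simp add: h_def)
      have "minor ?v' I U = minor v I U" if U: "U \<in> \<sigma>" and I: "I \<subseteq> {0..<n}" "card I = card U" for U I
      proof -
        have sub: "U \<subseteq> {0..<n}" "finite U" "finite I" using U \<sigma> \<F> I by (auto intro: finite_subset)
        have "c \<in> U \<longleftrightarrow> d \<in> U"
          using least_member_subset[OF U, of c] least_member_subset[OF U, of d] in_least_member[of c \<sigma>] in_least_member[of d \<sigma>] cd(4)
          by blast
        then have "(\<Prod>i\<in>U. ?t i) = 1" using sub h0 by (simp add: prod.distrib)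
        moreover have "minor ?v' I U = minor ?v\<^sub>1 I U"
          using sub I finM[OF cd(1)] least_member_subset[OF U, of c]
          by (intro minor_add_columns[where v = ?v\<^sub>1]) auto
        moreover have "minor ?v\<^sub>1 I U = minor v I U * (\<Prod>i\<in>U. ?t i)"
          using sub I by (intro minor_scale_columns) auto
        ultimately show ?thesis by simp
      qed
      then have "G j ?v' = G j v" if "j \<in> ?Jf" for j using that G_inv[of ?v' v] by auto
      moreover have "?v' (r, c) = u (Inr (r, c))" if r: "r \<in> ?M c" for r
      proof -
        have terms: "?h' i * ?v\<^sub>1 (r, i) = h i * v (r, i)" if "i \<in> ?M c - {c}" for i
          using that h0 by (cases "i = d") auto
        have "?v' (r, c) = ?v\<^sub>1 (r, c) + (\<Sum>i\<in>?M c - {c}. ?h' i * ?v\<^sub>1 (r, i))" by simp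
        also have "(\<Sum>i\<in>?M c - {c}. ?h' i * ?v\<^sub>1 (r, i)) = (\<Sum>i\<in>?M c - {c}. h i * v (r, i))"
          by (rule sum.cong[OF refl terms])
        also have "?v\<^sub>1 (r, c) = h c * v (r, c)" using cd(3) by simp
        also have "h c * v (r, c) + (\<Sum>i\<in>?M c - {c}. h i * v (r, i)) = (\<Sum>i\<in>?M c. h i * v (r, i))"
          using finM[OF cd(1)] in_least_member[of c \<sigma>] by (simp add: sum.remove)
        also have "\<dots> = (\<Sum>i\<in>?M c. \<Sum>s\<in>?M c. v (r, i) * B i s * u (Inr (s, c)))"
          by (simp add: h_def sum_distrib_right sum_distrib_left ac_simps)
        also have "\<dots> = (\<Sum>s\<in>?M c. (\<Sum>i\<in>?M c. v (r, i) * B i s) * u (Inr (s, c)))"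
          by (subst sum.swap) (simp add: sum_distrib_right)
        also have "\<dots> = (\<Sum>s\<in>?M c. if r = s then u (Inr (s, c)) else 0)"
          using r by (intro sum.cong refl) (simp add: B(1)[rule_format])
        also have "\<dots> = u (Inr (r, c))" using r finM[OF cd(1)] by simp
        finally show ?thesis .
      qed
      then have "G j ?v' = u j" if "j \<in> ?Jc" for j using that by (auto simp: G_def)
      ultimately show "\<exists>v'. (\<forall>j\<in>?Jf. G j v' = G j v) \<and> (\<forall>j\<in>?Jc. G j v' = u j)" by blast
    qed
  qed (auto simp: G_Inl)

  have indX: "alg_indep_on (?Jf \<union> ?Jc \<union> ?Jcols X) G UNIV" if "finite X" "X \<subseteq> {0..<n} - {c}" for X
    using that
  proof (induction X rule: finite_induct)
    case empty
    then show ?case using indc by simp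
  next
    case (insert j X)
    let ?K = "?M j - {j}"
    let ?Jj = "Inr ` (?K \<times> {j}) :: (nat + nat \<times> nat) set"
    have j: "j < n" "j \<noteq> c" using insert.prems by auto
    have K: "?K \<subseteq> {0..<n}" "finite ?K" using M[OF j(1)] finM[OF j(1)] by auto
    have "alg_indep_on (?Jf \<union> ?Jc \<union> ?Jcols X \<union> ?Jj) G UNIV"
    proof (rule alg_indep_on_Un[OF inf, where z = "\<lambda>v. det (mat n n (block ?K v))"
          and y\<^sub>0 = "\<lambda>(r, s). if r = s then 1 else 0"])
      show "alg_indep_on (?Jf \<union> ?Jc \<union> ?Jcols X) G UNIV" using insert by auto
      show "(?Jf \<union> ?Jc \<union> ?Jcols X) \<inter> ?Jj = {}" using insert.hyps j by auto
      show "G k \<in> polynomial_functions ?A" if "k \<in> ?Jf \<union> ?Jc \<union> ?Jcols X" for k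
        using that M insert.prems cd(1) by (fastforce intro!: G_Inl G_Inr)
      show "(\<lambda>v. det (mat n n (block ?K v))) \<in> polynomial_functions ?A"
        by (rule det_block_in_polynomial_functions)
      show "det (mat n n (block ?K (\<lambda>(r, s). if r = s then 1 else 0))) \<noteq> (0 :: 'k)"
        by (simp add: det_block_identity)
      fix v :: "nat \<times> nat \<Rightarrow> 'k" assume nz: "det (mat n n (block ?K v)) \<noteq> 0"
      from block_inverse[OF K(1) nz] obtain B where
        B: "\<forall>r\<in>?K. \<forall>s\<in>?K. (\<Sum>i\<in>?K. v (r, i) * B i s) = (if r = s then 1 else 0)"
        by (elim exE conjE)
      show "\<exists>l\<in>polynomial_functions ?Jj. (\<exists>u. l u \<noteq> 0) \<and> (\<forall>u. l u \<noteq> 0 \<longrightarrow>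
          (\<exists>v'. (\<forall>k\<in>?Jf \<union> ?Jc \<union> ?Jcols X. G k v' = G k v) \<and> (\<forall>k\<in>?Jj. G k v' = u k)))"
      proof (intro bexI conjI allI impI)
        show "(\<lambda>_. 1) \<in> polynomial_functions ?Jj" by (rule polynomial_functions.const)
        show "\<exists>u :: nat + nat \<times> nat \<Rightarrow> 'k. (1 :: 'k) \<noteq> 0" by simp
        fix u :: "nat + nat \<times> nat \<Rightarrow> 'k"
        define b where "b s = u (Inr (s, j)) - v (s, j)" for s
        define h where "h i = (\<Sum>s\<in>?K. B i s * b s)" for i
        let ?v' = "\<lambda>(r, s). if s = j then v (r, j) + (\<Sum>i\<in>?K. h i * v (r, i)) else v (r, s)"
        have "minor ?v' I U = minor v I U" if U: "U \<in> \<sigma>" and I: "I \<subseteq> {0..<n}" "card I = card U" for U I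
        proof -
          have "U \<subseteq> {0..<n}" "finite I" using U \<sigma> \<F> I by (auto intro: finite_subset)
          then show ?thesis using I K least_member_subset[OF U, of j] by (intro minor_add_columns) auto
        qed
        then have inv: "G (Inl i) ?v' = G (Inl i) v" for i by (rule G_inv)
        have "G k ?v' = G k v" if k: "k \<in> ?Jf \<union> ?Jc \<union> ?Jcols X" for k
        proof (cases k)
          case (Inl i)
          then show ?thesis by (simp only: inv)
        next
          case (Inr q)
          then have "snd q \<noteq> j" using k insert.hyps(2) j(2) by auto
          then show ?thesis using Inr by (simp add: G_def case_prod_beta)
        qed
        moreover have "?v' (r, j) = u (Inr (r, j))" if r: "r \<in> ?K" for r
        proof -
          have "(\<Sum>i\<in>?K. h i * v (r, i)) = (\<Sum>i\<in>?K. \<Sum>s\<in>?K. v (r, i) * B i s * b s)"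
            by (simp add: h_def sum_distrib_right sum_distrib_left ac_simps)
          also have "\<dots> = (\<Sum>s\<in>?K. (\<Sum>i\<in>?K. v (r, i) * B i s) * b s)"
            by (subst sum.swap) (simp add: sum_distrib_right)
          also have "\<dots> = (\<Sum>s\<in>?K. if r = s then b s else 0)"
            using r by (intro sum.cong refl) (simp add: B[rule_format] del: Diff_iff)
          also have "\<dots> = b r" using r K(2) by (simp del: Diff_iff)
          finally show ?thesis by (simp add: b_def)
        qed
        then have "G k ?v' = u k" if "k \<in> ?Jj" for k
          using that by (elim imageE SigmaE singletonE) (simp only: G_def sum.case)
        ultimately show "\<exists>v'. (\<forall>k\<in>?Jf \<union> ?Jc \<union> ?Jcols X. G k v' = G k v) \<and> (\<forall>k\<in>?Jj. G k v' = u k)"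
          by (intro exI[of _ ?v'] conjI ballI)
      qed
    qed
    moreover have "?Jf \<union> ?Jc \<union> ?Jcols X \<union> ?Jj = ?Jf \<union> ?Jc \<union> ?Jcols (insert j X)" by auto
    ultimately show ?case by simp
  qed

  let ?X = "{0..<n} - {c}"
  let ?R = "{(i, j). j < n \<and> i \<in> ?M j \<and> i \<noteq> j}" and ?R' = "{(r, j). j \<in> ?X \<and> r \<in> ?M j - {j}}"
  have R_sub: "?R \<subseteq> ?A" using M by auto
  then have fin: "finite ?R" "finite ?R'" by (auto intro: finite_subset[of _ ?A])
  have "card (?Jf \<union> ?Jc \<union> ?Jcols ?X) \<le> card ?A"
  proof (rule alg_indep_on_card_le[OF inf _ _ _ indX])
    show "finite (?Jf \<union> ?Jc \<union> ?Jcols ?X)" using fin finM[OF cd(1)] by simp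
    show "G k \<in> polynomial_functions ?A" if "k \<in> ?Jf \<union> ?Jc \<union> ?Jcols ?X" for k
      using that M cd(1) by (fastforce intro!: G_Inl G_Inr)
  qed auto
  moreover have "card (?Jf \<union> ?Jc \<union> ?Jcols ?X) = (m + 1) + card (?M c) + card ?R'"
  proof -
    have "card (?Jf \<union> ?Jc \<union> ?Jcols ?X) = card ?Jf + card ?Jc + card (?Jcols ?X)"
      using fin finM[OF cd(1)] by (subst card_Un_disjoint, auto)+
    then show ?thesis by (simp add: card_image card_cartesian_product)
  qed
  moreover have "card ?R = card (?M c - {c}) + card ?R'"
  proof -
    have "?R = (?M c - {c}) \<times> {c} \<union> ?R'" using cd(1) by auto
    moreover have "card ((?M c - {c}) \<times> {c} \<union> ?R') = card ((?M c - {c}) \<times> {c}) + card ?R'"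
      using fin finM[OF cd(1)] by (intro card_Un_disjoint) auto
    ultimately show ?thesis by (simp add: card_cartesian_product)
  qed
  moreover have "card (?M c) = card (?M c - {c}) + 1"
    using card_Suc_Diff1[OF finM[OF cd(1)] in_least_member] by simp
  ultimately show ?thesis by simp
qed

section \<open>Localized polynomial functions\<close>

text \<open>On the set where \<open>z\<close> does not vanish, these are the functions \<open>F / z ^ N\<close> with \<open>F\<close>
  polynomial; elsewhere their values are arbitrary. The chart of the orbit is of this kind, where \<open>z\<close>
  is the product of all diagonal entries but the last.\<close>

definition localized_functions :: "(('i \<Rightarrow> 'k) \<Rightarrow> 'k) \<Rightarrow> 'i set \<Rightarrow> (('i \<Rightarrow> 'k::field) \<Rightarrow> 'k) set" where
  "localized_functions z A = {\<phi>. \<exists>N. \<exists>F \<in> polynomial_functions A. \<forall>v. z v \<noteq> 0 \<longrightarrow> z v ^ N * \<phi> v = F v}"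

lemma polynomial_functions_localized: "f \<in> polynomial_functions A \<Longrightarrow> f \<in> localized_functions z A"
  unfolding localized_functions_def by (intro CollectI exI[of _ 0] bexI[of _ f]) auto

lemma inverse_localized: "(\<lambda>v. 1 / z v) \<in> localized_functions z A"
  unfolding localized_functions_def
  by (intro CollectI exI[of _ 1] bexI[of _ "\<lambda>_. 1"]) (auto intro: polynomial_functions.const)

lemma localized_functions_add:
  assumes "z \<in> polynomial_functions A" "f \<in> localized_functions z A" "g \<in> localized_functions z A"
  shows "(\<lambda>v. f v + g v) \<in> localized_functions z A"
proof -
  obtain N F M G where F: "F \<in> polynomial_functions A" "\<And>v. z v \<noteq> 0 \<Longrightarrow> z v ^ N * f v = F v"
    and G: "G \<in> polynomial_functions A" "\<And>v. z v \<noteq> 0 \<Longrightarrow> z v ^ M * g v = G v"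
    using assms(2,3) unfolding localized_functions_def by blast
  show ?thesis unfolding localized_functions_def
  proof (intro CollectI exI bexI allI impI)
    show "(\<lambda>v. z v ^ M * F v + z v ^ N * G v) \<in> polynomial_functions A"
      by (intro polynomial_functions.add polynomial_functions.mult polynomial_functions_power assms(1) F G)
    show "z v ^ (N + M) * (f v + g v) = z v ^ M * F v + z v ^ N * G v" if "z v \<noteq> 0" for v
      by (simp add: F(2)[OF that, symmetric] G(2)[OF that, symmetric] power_add algebra_simps)
  qed
qed

lemma localized_functions_mult:
  assumes "f \<in> localized_functions z A" "g \<in> localized_functions z A"
  shows "(\<lambda>v. f v * g v) \<in> localized_functions z A"
proof -
  obtain N F M G where F: "F \<in> polynomial_functions A" "\<And>v. z v \<noteq> 0 \<Longrightarrow> z v ^ N * f v = F v"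
    and G: "G \<in> polynomial_functions A" "\<And>v. z v \<noteq> 0 \<Longrightarrow> z v ^ M * g v = G v"
    using assms unfolding localized_functions_def by blast
  show ?thesis unfolding localized_functions_def
  proof (intro CollectI exI bexI allI impI)
    show "(\<lambda>v. F v * G v) \<in> polynomial_functions A" by (intro polynomial_functions.mult F G)
    show "z v ^ (N + M) * (f v * g v) = F v * G v" if "z v \<noteq> 0" for v
      by (simp add: F(2)[OF that, symmetric] G(2)[OF that, symmetric] power_add algebra_simps)
  qed
qed

lemma localized_functions_sum:
  assumes "z \<in> polynomial_functions A" "\<And>x. x \<in> X \<Longrightarrow> f x \<in> localized_functions z A"
  shows "(\<lambda>v. \<Sum>x\<in>X. f x v) \<in> localized_functions z A"
  using assms
  by (induction X rule: infinite_finite_induct)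
    (auto intro: localized_functions_add polynomial_functions_localized polynomial_functions.const)

lemma localized_functions_compose:
  assumes "P \<in> polynomial_functions I" "z \<in> polynomial_functions A"
    "\<And>i. i \<in> I \<Longrightarrow> f i \<in> localized_functions z A"
  shows "(\<lambda>v. P (\<lambda>i. f i v)) \<in> localized_functions z A"
  using assms
  by (induction) (auto intro: localized_functions_add localized_functions_mult
      polynomial_functions_localized polynomial_functions.const)

section \<open>The dimension of the orbit\<close>

text \<open>A chart of the orbit. The matrix is a product of a lower unitriangular one and an upper
  triangular one with zeros in the positions \<open>S\<close>; its free entries \<open>\<theta>\<close> are indexed by the pairs
  outside of \<open>S\<close> other than \<open>(n - 1, n - 1)\<close>, as this entry is determined by \<open>det = 1\<close>.\<close>

definition diag_prod :: "nat \<Rightarrow> (nat \<times> nat \<Rightarrow> 'k::field) \<Rightarrow> 'k" where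
  "diag_prod n \<theta> = (\<Prod>i = 0..<n - 1. \<theta> (i, i))"

definition lower_part :: "(nat \<times> nat \<Rightarrow> 'k::field) \<Rightarrow> nat \<times> nat \<Rightarrow> 'k" where
  "lower_part \<theta> = (\<lambda>(r, s). if r = s then 1 else if s < r then \<theta> (r, s) else 0)"

definition upper_part :: "nat \<Rightarrow> (nat \<times> nat) set \<Rightarrow> (nat \<times> nat \<Rightarrow> 'k::field) \<Rightarrow> nat \<times> nat \<Rightarrow> 'k" where
  "upper_part n S \<theta> = (\<lambda>(r, s). if r = s then (if r = n - 1 then 1 / diag_prod n \<theta> else \<theta> (r, r))
    else if r < s \<and> (r, s) \<notin> S then \<theta> (r, s) else 0)"

definition chart_matrix :: "nat \<Rightarrow> (nat \<times> nat) set \<Rightarrow> (nat \<times> nat \<Rightarrow> 'k::field) \<Rightarrow> nat \<times> nat \<Rightarrow> 'k" where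
  "chart_matrix n S \<theta> = (\<lambda>(r, s). \<Sum>l<n. lower_part \<theta> (r, l) * upper_part n S \<theta> (l, s))"

definition chart_index :: "nat \<Rightarrow> (nat \<times> nat) set \<Rightarrow> (nat \<times> nat) set" where
  "chart_index n S = {0..<n} \<times> {0..<n} - S - {(n - 1, n - 1)}"

text \<open>The parameters in \<open>X\<close> are switched on; the others have their values at the identity matrix.\<close>

definition fill_identity :: "(nat \<times> nat) set \<Rightarrow> (nat \<times> nat \<Rightarrow> 'k) \<Rightarrow> nat \<times> nat \<Rightarrow> 'k::field" where
  "fill_identity X \<theta> = (\<lambda>(r, s). if (r, s) \<in> X then \<theta> (r, s) else if r = s then 1 else 0)"

lemma card_chart_index:
  assumes "closed_root_subset n S" "n \<ge> 1"
  shows "card (chart_index n S) + card S + 1 = n * n"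
proof -
  let ?N = "{0..<n} \<times> {0..<n}"
  have S: "S \<subseteq> ?N" "(n - 1, n - 1) \<notin> S" using closed_root_subsetD[OF assms(1)] by fastforce+
  have "card (insert (n - 1, n - 1) S) = card S + 1"
    using S finite_subset[OF S(1)] by simp
  moreover have "card (?N - insert (n - 1, n - 1) S) + card (insert (n - 1, n - 1) S) = card ?N"
    using S(1) assms(2) finite_subset[OF S(1)] card_mono[of ?N "insert (n - 1, n - 1) S"]
    by (subst card_Diff_subset) auto
  moreover have "chart_index n S = ?N - insert (n - 1, n - 1) S" by (auto simp: chart_index_def)
  ultimately show ?thesis by simp
qed

lemma diag_prod_in_polynomial_functions:
  assumes "closed_root_subset n S"
  shows "diag_prod n \<in> polynomial_functions (chart_index n S)"
proof -
  have "(i, i) \<in> chart_index n S" if "i < n - 1" for i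
    using that closed_root_subsetD(1)[OF assms, of i i] by (auto simp: chart_index_def)
  then have "(\<lambda>\<theta>. \<Prod>i = 0..<n - 1. \<theta> (i, i)) \<in> polynomial_functions (chart_index n S)"
    by (intro polynomial_functions_prod polynomial_functions.coord) auto
  then show ?thesis unfolding diag_prod_def[abs_def] .
qed

lemma chart_matrix_localized:
  assumes S: "closed_root_subset n S" and rs: "r < n" "s < n"
  shows "(\<lambda>\<theta>. chart_matrix n S \<theta> (r, s)) \<in> localized_functions (diag_prod n) (chart_index n S)"
proof -
  let ?R = "localized_functions (diag_prod n) (chart_index n S)"
  have const: "(\<lambda>_. c) \<in> ?R" for c by (intro polynomial_functions_localized polynomial_functions.const)
  have coord: "(\<lambda>\<theta>. \<theta> (r, s)) \<in> ?R" if "r < n" "s < n" "(r, s) \<notin> S" "(r, s) \<noteq> (n - 1, n - 1)" for r s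
    using that by (intro polynomial_functions_localized polynomial_functions.coord) (auto simp: chart_index_def)
  have lower: "(\<lambda>\<theta>. lower_part \<theta> (r, l)) \<in> ?R" if "l < n" for l
  proof (cases "l < r")
    case True
    then have "(r, l) \<notin> S" using closed_root_subsetD(1)[OF S] by fastforce
    then show ?thesis using True rs that coord[of r l] by (simp add: lower_part_def)
  next
    case False
    then show ?thesis using const by (cases "r = l") (simp_all add: lower_part_def)
  qed
  have upper: "(\<lambda>\<theta>. upper_part n S \<theta> (l, s)) \<in> ?R" if l: "l < n" for l
  proof -
    consider "l = s" "l = n - 1" | "l = s" "l \<noteq> n - 1" | "l < s" "(l, s) \<notin> S" | "l \<noteq> s" "\<not> (l < s \<and> (l, s) \<notin> S)"
      by blast
    then show ?thesis
    proof cases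
      case 1
      then show ?thesis using inverse_localized by (simp add: upper_part_def)
    next
      case 2
      then have "(l, l) \<notin> S" using closed_root_subsetD(1)[OF S, of l l] by auto
      then show ?thesis using 2 l coord[of l l] by (simp add: upper_part_def)
    next
      case 3
      then show ?thesis using l rs coord[of l s] by (simp add: upper_part_def)
    next
      case 4
      then show ?thesis using const by (auto simp: upper_part_def)
    qed
  qed
  show ?thesis
    unfolding chart_matrix_def prod.case
    by (intro localized_functions_sum diag_prod_in_polynomial_functions[OF S] localized_functions_mult
        lower upper) auto
qed

lemma det_chart_matrix:
  assumes n: "n \<ge> 1" and nz: "diag_prod n \<theta> \<noteq> 0"
  shows "det (mat n n (chart_matrix n S \<theta>)) = 1"
proof -
  have "det (mat n n (lower_part \<theta>)) = 1"
  proof -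
    have "det (mat n n (lower_part \<theta>)) = prod_list (diag_mat (mat n n (lower_part \<theta>)))"
      by (rule det_lower_triangular[of n]) (auto simp: lower_part_def)
    then show ?thesis by (simp add: prod_list_diag_prod lower_part_def)
  qed
  moreover have "det (mat n n (upper_part n S \<theta>)) = 1"
  proof -
    obtain m where m: "n = Suc m" using n by (cases n) auto
    have "det (mat n n (upper_part n S \<theta>)) = prod_list (diag_mat (mat n n (upper_part n S \<theta>)))"
      by (rule det_upper_triangular[of _ n]) (auto simp: upper_part_def)
    also have "\<dots> = (\<Prod>i = 0..<n. if i = n - 1 then 1 / diag_prod n \<theta> else \<theta> (i, i))"
      by (simp add: prod_list_diag_prod upper_part_def)
    also have "\<dots> = (\<Prod>i = 0..<m. \<theta> (i, i)) * (1 / diag_prod n \<theta>)"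
      unfolding m by (simp add: prod.atLeast0_lessThan_Suc)
    also have "\<dots> = 1" using nz by (simp add: diag_prod_def m)
    finally show ?thesis .
  qed
  moreover have "minor (chart_matrix n S \<theta>) {0..<n} {0..<n} =
      minor (lower_part \<theta>) {0..<n} {0..<n} * minor (upper_part n S \<theta>) {0..<n} {0..<n}"
    unfolding chart_matrix_def by (rule minor_mult) auto
  ultimately show ?thesis by (simp add: minor_full_eq_det)
qed

lemma chart_matrix_no_lower:
  assumes "\<And>r s. s < r \<Longrightarrow> r < n \<Longrightarrow> \<theta> (r, s) = 0" "r < n"
  shows "chart_matrix n S \<theta> (r, s) = upper_part n S \<theta> (r, s)"
proof -
  have "chart_matrix n S \<theta> (r, s) = (\<Sum>l<n. if l = r then upper_part n S \<theta> (l, s) else 0)"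
    unfolding chart_matrix_def prod.case using assms by (intro sum.cong) (auto simp: lower_part_def)
  then show ?thesis using assms(2) by simp
qed

lemma chart_matrix_elementary:
  assumes q: "(i, j) \<in> chart_index n S" "i \<noteq> j" and rs: "r < n" "s < n"
  defines "\<theta> \<equiv> fill_identity {(i, j)} (\<lambda>_. 1 :: 'k::field)"
  shows "chart_matrix n S \<theta> (r, s) = (if r = s \<or> (r = i \<and> s = j) then 1 else 0)"
proof -
  have diag: "diag_prod n \<theta> = 1"
    unfolding diag_prod_def \<theta>_def fill_identity_def using q(2) by (intro prod.neutral) auto
  show ?thesis
  proof (cases "i < j")
    case True
    have "chart_matrix n S \<theta> (r, s) = upper_part n S \<theta> (r, s)"
      using rs True by (intro chart_matrix_no_lower) (auto simp: \<theta>_def fill_identity_def)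
    then show ?thesis
      using q True diag by (auto simp: upper_part_def \<theta>_def fill_identity_def chart_index_def)
  next
    case False
    have upper: "upper_part n S \<theta> (l, s) = (if l = s then 1 else 0)" for l
      using q(2) False diag by (auto simp: upper_part_def \<theta>_def fill_identity_def)
    have "chart_matrix n S \<theta> (r, s) = (\<Sum>l<n. if l = s then lower_part \<theta> (r, l) else 0)"
      unfolding chart_matrix_def prod.case upper by (intro sum.cong) auto
    also have "\<dots> = lower_part \<theta> (r, s)" using rs by simp
    finally show ?thesis
      using q(2) False by (auto simp: lower_part_def \<theta>_def fill_identity_def)
  qed
qed

text \<open>The parameters are switched on one after the other: the diagonal, then the upper entries
  from the last column to the first, then the lower entries.\<close>

definition chart_stage :: "nat \<Rightarrow> nat \<times> nat \<Rightarrow> nat" where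
  "chart_stage n = (\<lambda>(i, j). if i = j then 0 else if i < j then n - j else n + 1)"

text \<open>Each new parameter \<open>(i, j)\<close> is seen by a coordinate of the orbit: on the diagonal by comparing
  the minors at \<open>S\<^sub>i\<close> and \<open>S\<^sub>i - {i}\<close>; above it by the minor with columns \<open>S\<^sub>j\<close> and rows
  \<open>S\<^sub>j - {j} \<union> {i}\<close>, where all columns but the last are still those of a diagonal matrix; below it
  by the one with columns \<open>0, \<dots>, j\<close> and rows \<open>0, \<dots>, j - 1, i\<close>, which is, up to a factor, a minor of
  the lower triangular matrix.\<close>

lemma chart_witness:
  fixes a :: "'k::field"
  assumes S: "closed_root_subset n S" and a: "a \<noteq> 0" "a \<noteq> 1"
    and q: "q \<in> chart_index n S" and X: "q \<notin> X" "\<And>x. x \<in> X \<Longrightarrow> chart_stage n x \<le> chart_stage n q"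
      "X \<subseteq> chart_index n S"
  defines "\<F> \<equiv> union_family n S"
  shows "\<exists>h \<in> polynomial_functions (W_index n \<F>).
    (\<forall>\<theta>. h (orbit_point n \<F> \<F> (chart_matrix n S (fill_identity X \<theta>))) = 0) \<and>
    (\<exists>\<theta> :: nat \<times> nat \<Rightarrow> 'k. diag_prod n (fill_identity {q} \<theta>) \<noteq> 0 \<and>
      h (orbit_point n \<F> \<F> (chart_matrix n S (fill_identity {q} \<theta>))) \<noteq> 0)"
proof -
  obtain i j where ij: "q = (i, j)" by fastforce
  have ijn: "i < n" "j < n" "(i, j) \<notin> S" "(i, j) \<noteq> (n - 1, n - 1)"
    using q by (auto simp: ij chart_index_def)
  have Pow: "\<F> \<subseteq> Pow {0..<n}" unfolding \<F>_def by (rule union_family_subset_Pow[OF S])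
  have S_trans: "(a, c) \<in> S" if "(a, b) \<in> S" "(b, c) \<in> S" for a b c
    using S that unfolding closed_root_subset_def by blast
  let ?Y = "\<lambda>\<theta> :: nat \<times> nat \<Rightarrow> 'k. orbit_point n \<F> \<F> (chart_matrix n S \<theta>)"
  have coord: "?Y \<theta> (U, I) = minor (chart_matrix n S \<theta>) I U"
    if "U \<in> \<F>" "I \<subseteq> {0..<n}" "card I = card U" for \<theta> U I
    using that by (simp add: orbit_point_def W_index_def)
  have S_j: "col_support S j \<in> \<F>" if "j < n" for j
    unfolding \<F>_def union_family_iff[OF S]
  proof (intro conjI allI impI)
    show "col_support S j \<subseteq> {0..<n}"
      using that closed_root_subsetD(1)[OF S] by (force simp: col_support_def)
    show "l \<in> col_support S j" if "(l, m) \<in> S \<and> m \<in> col_support S j" for l m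
      using that S_trans[of l m j] by (auto simp: col_support_def)
  qed (simp add: col_support_def)
  \<comment> \<open>The coordinate with columns \<open>U\<close> and rows \<open>U - {j} \<union> {i}\<close> detects the parameter \<open>(i, j)\<close>.\<close>
  have off_diag: ?thesis
    if U: "U \<in> \<F>" "j \<in> U" "i \<notin> U"
      and zero: "\<And>\<theta> :: nat \<times> nat \<Rightarrow> 'k. minor (chart_matrix n S (fill_identity X \<theta>)) (insert i (U - {j})) U = 0" for U
  proof -
    let ?I = "insert i (U - {j})"
    have Un: "U \<subseteq> {0..<n}" "finite U" using U Pow by (auto intro: finite_subset)
    have I: "?I \<subseteq> {0..<n}" "card ?I = card U" "finite ?I"
      using U Un ijn(1) card_Suc_Diff1[OF Un(2) U(2)] by auto
    have neq: "i \<noteq> j" using U by auto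
    let ?\<theta> = "\<lambda>_. 1 :: 'k"
    have "minor (chart_matrix n S (fill_identity {(i, j)} ?\<theta>)) ?I U =
        minor (\<lambda>(r, s). if r = s \<or> (r = i \<and> s = j) then 1 else 0) ?I U"
    proof (rule minor_cong)
      fix r s assume "r \<in> ?I" "s \<in> U"
      then have "r < n" "s < n" using I(1) Un(1) by auto
      then show "chart_matrix n S (fill_identity {(i, j)} ?\<theta>) (r, s) =
          (\<lambda>(r, s). if r = s \<or> (r = i \<and> s = j) then 1 else 0) (r, s)"
        using chart_matrix_elementary[OF q[unfolded ij] neq, of r s] by simp
    qed (use I Un in auto)
    also have "\<dots> \<noteq> 0" using Un U by (intro minor_elementary_nonzero) auto
    finally have "?Y (fill_identity {q} ?\<theta>) (U, ?I) \<noteq> 0" using coord[OF U(1) I(1,2)] ij by simp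
    moreover have "diag_prod n (fill_identity {q} ?\<theta>) \<noteq> 0"
      unfolding ij diag_prod_def fill_identity_def using neq by (auto simp: prod_zero_iff)
    moreover have "(\<lambda>y. y (U, ?I)) \<in> polynomial_functions (W_index n \<F>)"
      using U I by (intro polynomial_functions.coord) (auto simp: W_index_def)
    ultimately show ?thesis
      using zero coord[OF U(1) I(1,2)] by (intro bexI[of _ "\<lambda>y. y (U, ?I)"] conjI allI exI[of _ ?\<theta>]) auto
  qed
  have not_X: "(r, s) \<notin> X" if "chart_stage n (i, j) < chart_stage n (r, s)" for r s
    using X(2)[of "(r, s)"] that unfolding ij by auto
  consider "i = j" | "i < j" | "j < i" by linarith
  then show ?thesis
  proof cases
    case 1
    let ?U = "col_support S i"
    have i: "i < n - 1" using ijn 1 by auto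
    have U: "?U \<in> \<F>" "i \<in> ?U" "finite ?U" using S_j[OF ijn(1)] Pow by (auto simp: col_support_def intro: finite_subset)
    have below: "l < i" if "l \<in> ?U - {i}" for l
      using that closed_root_subsetD(1)[OF S] by (auto simp: col_support_def)
    have U': "?U - {i} = {} \<or> ?U - {i} \<in> \<F>"
    proof -
      have "?U - {i} \<subseteq> {0..<n}" using U(1) Pow by auto
      moreover have "l \<in> ?U - {i}" if "(l, m) \<in> S" "m \<in> ?U - {i}" for l m
      proof -
        have "(m, i) \<in> S" using that by (auto simp: col_support_def)
        then have "(l, i) \<in> S" using S_trans that(1) by blast
        then show ?thesis using closed_root_subsetD(1)[OF S, of l i] by (auto simp: col_support_def)
      qed
      ultimately show ?thesis unfolding \<F>_def union_family_iff[OF S] by blast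
    qed
    define h where "h y = y (?U, ?U) - (if ?U - {i} = {} then 1 else y (?U - {i}, ?U - {i}))"
      for y :: "nat set \<times> nat set \<Rightarrow> 'k"
    have h_poly: "h \<in> polynomial_functions (W_index n \<F>)"
      using U(1) U' Pow unfolding h_def
      by (cases "?U - {i} = {}")
        (auto simp: W_index_def simp del: Diff_eq_empty_iff intro!: polynomial_functions_diff polynomial_functions.intros)
    \<comment> \<open>Only the diagonal parameters are switched on, so minors are products of them.\<close>
    have h_eq: "h (?Y \<theta>) = (\<theta> (i, i) - 1) * (\<Prod>l\<in>?U - {i}. \<theta> (l, l))"
      if \<theta>: "\<And>r s. r \<noteq> s \<Longrightarrow> \<theta> (r, s) = 0" for \<theta>
    proof -
      have minor: "minor (chart_matrix n S \<theta>) V V = (\<Prod>l\<in>V. \<theta> (l, l))" if V: "V \<subseteq> ?U" for V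
      proof -
        have Vn: "l < n - 1" if "l \<in> V" for l using that V below[of l] i by (cases "l = i") auto
        have "minor (chart_matrix n S \<theta>) V V = minor (\<lambda>(r, s). if r = s then \<theta> (r, r) else 0) V V"
        proof (rule minor_cong)
          fix r s assume "r \<in> V" "s \<in> V"
          then have "r < n" "r \<noteq> n - 1" using Vn[of r] by auto
          then show "chart_matrix n S \<theta> (r, s) = (case (r, s) of (r, s) \<Rightarrow> if r = s then \<theta> (r, r) else 0)"
            using \<theta> by (subst chart_matrix_no_lower) (auto simp: upper_part_def)
        qed (use finite_subset[OF V U(3)] in auto)
        then show ?thesis using minor_diagonal[OF finite_subset[OF V U(3)]] by simp
      qed
      have "?Y \<theta> (?U, ?U) = (\<Prod>l\<in>?U. \<theta> (l, l))" using coord[of ?U ?U] minor U Pow by auto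
      moreover have "(if ?U - {i} = {} then 1 else ?Y \<theta> (?U - {i}, ?U - {i})) = (\<Prod>l\<in>?U - {i}. \<theta> (l, l))"
      proof (cases "?U - {i} = {}")
        case True
        then show ?thesis by (simp only: if_True prod.empty refl)
      next
        case False
        then have "?Y \<theta> (?U - {i}, ?U - {i}) = (\<Prod>l\<in>?U - {i}. \<theta> (l, l))"
          using coord[of "?U - {i}" "?U - {i}"] minor[of "?U - {i}"] U' Pow by auto
        then show ?thesis using False by (simp only: if_False)
      qed
      moreover have "(\<Prod>l\<in>?U. \<theta> (l, l)) = \<theta> (i, i) * (\<Prod>l\<in>?U - {i}. \<theta> (l, l))"
        using U by (intro prod.remove) auto
      ultimately show ?thesis unfolding h_def by (simp only:) (simp add: algebra_simps)
    qed
    have "h (?Y (fill_identity X \<theta>)) = 0" for \<theta>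
    proof -
      have "fill_identity X \<theta> (r, s) = 0" if "r \<noteq> s" for r s
      proof -
        have "(r, s) \<notin> X"
        proof
          assume "(r, s) \<in> X"
          then have "chart_stage n (r, s) \<le> chart_stage n (i, j)" "s < n"
            using X(2,3) by (auto simp: ij chart_index_def)
          then show False using that 1 by (auto simp: chart_stage_def split: if_splits)
        qed
        then show ?thesis using that by (simp add: fill_identity_def)
      qed
      moreover have "fill_identity X \<theta> (i, i) = 1" using X(1) ij 1 by (simp add: fill_identity_def)
      ultimately show ?thesis by (subst h_eq) auto
    qed
    moreover have "h (?Y (fill_identity {q} (\<lambda>_. a))) \<noteq> 0"
      using a 1 ij below
      by (subst h_eq) (auto simp: fill_identity_def prod_zero_iff)
    moreover have "diag_prod n (fill_identity {q} (\<lambda>_. a)) \<noteq> 0"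
      unfolding diag_prod_def fill_identity_def using a by (auto simp: prod_zero_iff)
    ultimately show ?thesis using h_poly by blast
  next
    case 2
    show ?thesis
    proof (rule off_diag[OF S_j[OF ijn(2)]])
      show "j \<in> col_support S j" "i \<notin> col_support S j" using 2 ijn by (auto simp: col_support_def)
      fix \<theta> :: "nat \<times> nat \<Rightarrow> 'k"
      let ?U = "col_support S j"
      have U: "finite ?U" "j \<in> ?U" "i \<notin> ?U"
        using S_j[OF ijn(2)] Pow 2 ijn by (auto simp: col_support_def intro: finite_subset)
      show "minor (chart_matrix n S (fill_identity X \<theta>)) (insert i (?U - {j})) ?U = 0"
      proof (rule minor_eq_0_if_zero_row)
        show "card (insert i (?U - {j})) = card ?U" using U card_Suc_Diff1[OF U(1,2)] by simp
        fix s assume s: "s \<in> ?U"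
        have "chart_matrix n S (fill_identity X \<theta>) (i, s) = upper_part n S (fill_identity X \<theta>) (i, s)"
        proof (rule chart_matrix_no_lower[OF _ ijn(1)])
          fix r s :: nat assume "s < r"
          then have "(r, s) \<notin> X" using 2 ijn by (intro not_X) (auto simp: chart_stage_def)
          then show "fill_identity X \<theta> (r, s) = 0" using \<open>s < r\<close> by (simp add: fill_identity_def)
        qed
        also have "\<dots> = 0"
        proof (cases "s = j")
          case True
          then show ?thesis using X(1) 2 by (simp add: ij upper_part_def fill_identity_def)
        next
          case False
          then have sj: "s < j" using s closed_root_subsetD(1)[OF S] by (auto simp: col_support_def)
          have "(i, s) \<notin> X" if "i < s"
            using that 2 sj ijn by (intro not_X) (auto simp: chart_stage_def)
          moreover have "i \<noteq> s" using U(3) s by auto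
          ultimately show ?thesis by (simp add: upper_part_def fill_identity_def)
        qed
        finally show "chart_matrix n S (fill_identity X \<theta>) (i, s) = 0" .
      qed (use U in auto)
    qed
  next
    case 3
    let ?U = "{0..<Suc j}"
    have U: "?U \<in> \<F>"
      unfolding \<F>_def union_family_iff[OF S] using ijn(2) closed_root_subsetD(1)[OF S] by fastforce
    show ?thesis
    proof (rule off_diag[OF U])
      show "j \<in> ?U" "i \<notin> ?U" using 3 by auto
      fix \<theta> :: "nat \<times> nat \<Rightarrow> 'k"
      let ?L = "lower_part (fill_identity X \<theta>)" and ?I = "insert i (?U - {j})"
      have card: "card ?I = card ?U" using 3 by simp
      have "minor (chart_matrix n S (fill_identity X \<theta>)) ?I ?U =
          minor ?L ?I ?U * minor (upper_part n S (fill_identity X \<theta>)) ?U ?U"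
        unfolding chart_matrix_def using ijn card
        by (intro minor_mult) (auto simp: upper_part_def)
      moreover have "minor ?L ?I ?U = 0"
        using card 3 X(1) by (intro minor_eq_0_if_zero_col[of _ _ j]) (auto simp: ij lower_part_def fill_identity_def)
      ultimately show "minor (chart_matrix n S (fill_identity X \<theta>)) ?I ?U = 0" by simp
    qed
  qed
qed

text \<open>The set \<open>V k\<close> of the orbit points for which only the first \<open>k\<close> parameters are switched on is
  irreducible, because polynomials pull back to localized polynomial functions of the parameters,
  and these form an integral domain.\<close>

lemma zariski_dim_SL_orbit_ge:
  assumes inf: "infinite (UNIV :: 'k::field set)" and S: "closed_root_subset n S" and n: "n \<ge> 1"
  defines "\<F> \<equiv> union_family n S"
  shows "ereal (real (card (chart_index n S))) \<le> zariski_dim (W_index n \<F>) (SL_orbit n \<F> :: (_ \<Rightarrow> 'k) set)"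
proof -
  let ?Q = "chart_index n S"
  have Pow: "\<F> \<subseteq> Pow {0..<n}" unfolding \<F>_def by (rule union_family_subset_Pow[OF S])
  have finQ: "finite ?Q" by (rule finite_subset[of _ "{0..<n} \<times> {0..<n}"]) (auto simp: chart_index_def)
  define qs where "qs = sort_key (chart_stage n) (SOME xs. set xs = ?Q \<and> distinct xs)"
  have "set (SOME xs. set xs = ?Q \<and> distinct xs) = ?Q \<and> distinct (SOME xs. set xs = ?Q \<and> distinct xs)"
    by (rule someI_ex) (rule finite_distinct_list[OF finQ])
  then have qs: "set qs = ?Q" "distinct qs" "sorted (map (chart_stage n) qs)"
    by (auto simp: qs_def)
  then have len: "length qs = card ?Q" using distinct_card by metis
  let ?Y = "\<lambda>\<theta> :: nat \<times> nat \<Rightarrow> 'k. orbit_point n \<F> \<F> (chart_matrix n S \<theta>)"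
  define X where "X k = set (take k qs)" for k
  define V where "V k = {?Y (fill_identity (X k) \<theta>) | \<theta>. diag_prod n (fill_identity (X k) \<theta>) \<noteq> 0}" for k
  note z_poly = diag_prod_in_polynomial_functions[OF S]
  obtain a :: 'k where a: "a \<noteq> 0" "a \<noteq> 1"
  proof -
    have "\<exists>a :: 'k. a \<notin> {0, 1}" using inf by (metis ex_new_if_finite finite.emptyI finite_insert)
    then show thesis using that by auto
  qed
  have fill_fill: "fill_identity X (fill_identity X' \<theta>) = fill_identity X' \<theta>" if "X' \<subseteq> X" for X X' and \<theta> :: "_ \<Rightarrow> 'k"
    using that by (auto simp: fill_identity_def fun_eq_iff)
  show ?thesis
  proof (rule zariski_dim_geI[where V = V])
    show "SL_orbit n \<F> \<subseteq> W_index n \<F> \<rightarrow>\<^sub>E (UNIV :: 'k set)"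
      unfolding SL_orbit_eq[OF Pow] orbit_point_def by auto
    show "V k \<subseteq> SL_orbit n \<F>" for k
      unfolding SL_orbit_eq[OF Pow] V_def using det_chart_matrix[OF n] by blast
    show "V k \<noteq> {}" for k
    proof -
      have "diag_prod n (fill_identity (X k) (\<lambda>_. 1 :: 'k)) \<noteq> 0"
        unfolding diag_prod_def fill_identity_def by (auto simp: prod_zero_iff)
      then show ?thesis unfolding V_def by blast
    qed
    show "V k \<subseteq> V (Suc k)" for k
    proof -
      have "X k \<subseteq> X (Suc k)" unfolding X_def by (rule set_take_subset_set_take) simp
      then show ?thesis unfolding V_def using fill_fill by (smt (verit, ccfv_SIG) Collect_mono)
    qed
    show "(\<forall>y\<in>V k. F y = 0) \<or> (\<forall>y\<in>V k. G y = 0)"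
      if F: "F \<in> polynomial_functions (W_index n \<F>)" and G: "G \<in> polynomial_functions (W_index n \<F>)"
        and zero: "\<forall>y\<in>V k. F y * G y = 0" for k F G
    proof -
      have fill: "(\<lambda>\<theta>. P (fill_identity (X k) \<theta>)) \<in> polynomial_functions ?Q"
        if "P \<in> polynomial_functions ?Q" for P :: "(nat \<times> nat \<Rightarrow> 'k) \<Rightarrow> 'k"
        by (rule polynomial_functions_compose[OF that], rename_tac rs, case_tac "rs \<in> X k")
          (auto simp: fill_identity_def intro: polynomial_functions.intros)
      have loc: "\<exists>N. \<exists>P' \<in> polynomial_functions ?Q. \<forall>\<theta>. diag_prod n \<theta> \<noteq> 0 \<longrightarrow>
          diag_prod n \<theta> ^ N * P (?Y \<theta>) = P' \<theta>" if P: "P \<in> polynomial_functions (W_index n \<F>)" for P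
      proof -
        have "(\<lambda>\<theta>. ?Y \<theta> UI) \<in> localized_functions (diag_prod n) ?Q" if UI: "UI \<in> W_index n \<F>" for UI
          by (rule localized_functions_compose[OF orbit_point_in_polynomial_functions[OF Pow UI] z_poly,
              where f = "\<lambda>rs \<theta>. chart_matrix n S \<theta> rs"]) (auto intro: chart_matrix_localized[OF S])
        from localized_functions_compose[OF P z_poly this] show ?thesis
          by (simp add: localized_functions_def)
      qed
      obtain N F' M G' where
        F': "F' \<in> polynomial_functions ?Q" "\<And>\<theta>. diag_prod n \<theta> \<noteq> 0 \<Longrightarrow> diag_prod n \<theta> ^ N * F (?Y \<theta>) = F' \<theta>"
        and G': "G' \<in> polynomial_functions ?Q" "\<And>\<theta>. diag_prod n \<theta> \<noteq> 0 \<Longrightarrow> diag_prod n \<theta> ^ M * G (?Y \<theta>) = G' \<theta>"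
        using loc[OF F] loc[OF G] by blast
      let ?z = "\<lambda>\<theta>. diag_prod n (fill_identity (X k) \<theta>)"
      let ?F = "\<lambda>\<theta>. F' (fill_identity (X k) \<theta>)" and ?G = "\<lambda>\<theta>. G' (fill_identity (X k) \<theta>)"
      have "?z \<theta> * ?F \<theta> * ?G \<theta> = 0" for \<theta>
      proof (cases "?z \<theta> = 0")
        case False
        then have "?Y (fill_identity (X k) \<theta>) \<in> V k" unfolding V_def by blast
        then have "F (?Y (fill_identity (X k) \<theta>)) * G (?Y (fill_identity (X k) \<theta>)) = 0" using zero by blast
        then show ?thesis using F'(2)[OF False] G'(2)[OF False] by auto
      qed simp
      then have "(\<forall>\<theta>. ?z \<theta> * ?F \<theta> = 0) \<or> (\<forall>\<theta>. ?G \<theta> = 0)"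
        by (intro polynomial_functions_mult_eq_0[OF inf, where A = ?Q] polynomial_functions.mult fill F'(1) G'(1) z_poly)
      then show ?thesis
      proof
        assume "\<forall>\<theta>. ?z \<theta> * ?F \<theta> = 0"
        then have "F (?Y (fill_identity (X k) \<theta>)) = 0" if "?z \<theta> \<noteq> 0" for \<theta>
          using that F'(2)[OF that] by auto
        then show ?thesis unfolding V_def by blast
      next
        assume "\<forall>\<theta>. ?G \<theta> = 0"
        then have "G (?Y (fill_identity (X k) \<theta>)) = 0" if "?z \<theta> \<noteq> 0" for \<theta>
          using that G'(2)[OF that] by auto
        then show ?thesis unfolding V_def by blast
      qed
    qed
    show "\<exists>h \<in> polynomial_functions (W_index n \<F>). (\<forall>y\<in>V k. h y = 0) \<and> (\<exists>y\<in>V (Suc k). h y \<noteq> 0)"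
      if k: "k < card ?Q" for k
    proof -
      have k': "k < length qs" using k len by simp
      have q: "qs ! k \<in> ?Q" using qs(1) nth_mem[OF k'] by simp
      have not_in: "qs ! k \<notin> X k"
        using qs(2) k' unfolding X_def by (auto simp: in_set_conv_nth nth_eq_iff_index_eq)
      have stage: "chart_stage n x \<le> chart_stage n (qs ! k)" if "x \<in> X k" for x
        using that qs(3) k' unfolding X_def
        by (auto simp: in_set_conv_nth sorted_iff_nth_mono)
      have X_sub: "X k \<subseteq> ?Q" using qs(1) set_take_subset unfolding X_def by fast
      obtain h and \<theta> :: "nat \<times> nat \<Rightarrow> 'k" where h: "h \<in> polynomial_functions (W_index n \<F>)"
        "\<And>\<theta>. h (?Y (fill_identity (X k) \<theta>)) = 0"
        "diag_prod n (fill_identity {qs ! k} \<theta>) \<noteq> 0" "h (?Y (fill_identity {qs ! k} \<theta>)) \<noteq> 0"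
        using chart_witness[OF S a q not_in stage X_sub] unfolding \<F>_def by blast
      have "{qs ! k} \<subseteq> X (Suc k)" unfolding X_def using k' by (simp add: take_Suc_conv_app_nth)
      from fill_fill[OF this, of \<theta>] have "?Y (fill_identity {qs ! k} \<theta>) \<in> V (Suc k)"
        using h(3) unfolding V_def by (metis (mono_tags, lifting) mem_Collect_eq)
      then show ?thesis using h unfolding V_def by blast
    qed
  qed
qed

section \<open>Codimension of the toric boundary\<close>

text \<open>It remains to compare the number of pairs: \<open>S\<close> is contained in the set of all \<open>(i, j)\<close> such that
  \<open>i \<noteq> j\<close> is in the least member containing \<open>j\<close>. The inclusion is strict, since that set contains
  both \<open>(c, d)\<close> and \<open>(d, c)\<close> when \<open>c\<close> and \<open>d\<close> have the same least member, and \<open>S\<close> at most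
  one of them.\<close>

theorem theorem1p4:
  fixes \<iota> :: "'k::alg_closed_field \<Rightarrow> complex"
    and n :: nat and S :: "(nat \<times> nat) set" and U :: "'k mat set"
  assumes "field_hom \<iota>"
    and "n \<ge> 1"
    and "closed_root_subset n S"
    and "U = regular_subgroup n S"
  shows "zariski_dim (W_index n (union_family n S))
           (toric_closure n (union_family n S) - (SL_orbit n (union_family n S) :: (_ \<Rightarrow> 'k) set))
         \<le> zariski_dim (W_index n (union_family n S))
             (SL_orbit n (union_family n S) :: (_ \<Rightarrow> 'k) set) - 2"
proof -
  let ?F = "union_family n S"
  let ?N = "real (card (chart_index n S))"
  let ?\<Sigma> = "{\<sigma>. \<sigma> \<subseteq> ?F \<and> {0..<n} \<in> \<sigma> \<and> (\<exists>c<n. \<exists>d<n. c \<noteq> d \<and> least_member \<sigma> c = least_member \<sigma> d)}"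
  note S = assms(3)
  have Pow: "?F \<subseteq> Pow {0..<n}" by (rule union_family_subset_Pow[OF S])
  have inf: "infinite (UNIV :: 'k set)"
  proof
    interpret field_hom \<iota> by fact
    assume "finite (UNIV :: 'k set)"
    then have "finite (range (of_nat :: nat \<Rightarrow> 'k))" by (rule finite_subset[OF subset_UNIV])
    moreover have "inj (of_nat :: nat \<Rightarrow> 'k)"
      by (rule injI) (metis hom_of_nat of_nat_eq_iff)
    ultimately have "finite (UNIV :: nat set)" by (rule finite_imageD)
    then show False by simp
  qed
  have "zariski_dim (W_index n ?F) (toric_closure n ?F - (SL_orbit n ?F :: (_ \<Rightarrow> 'k) set)) \<le> ereal (?N - 2)"
  proof (rule zariski_dim_leI[OF inf, where e = "Inl :: nat \<Rightarrow> nat + nat \<times> nat" and X = ?\<Sigma>])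
    show "inj (Inl :: nat \<Rightarrow> nat + nat \<times> nat)" by simp
    have "?\<Sigma> \<subseteq> Pow (Pow {0..<n})" using Pow by blast
    then show "finite ?\<Sigma>" by (rule finite_subset) simp
    show "toric_closure n ?F - SL_orbit n ?F \<subseteq>
        (\<Union>\<sigma>\<in>?\<Sigma>. orbit_point n ?F \<sigma> ` {v :: nat \<times> nat \<Rightarrow> 'k. det (mat n n v) = 1})"
      by (rule toric_boundary_subset[OF S assms(2)])
    fix \<sigma> m and f :: "nat + nat \<times> nat \<Rightarrow> (nat set \<times> nat set \<Rightarrow> 'k) \<Rightarrow> 'k"
    assume "\<sigma> \<in> ?\<Sigma>" and f: "\<And>i. i < m \<Longrightarrow> f (Inl i) \<in> polynomial_functions (W_index n ?F)"
      "alg_indep_on (Inl ` {..<m}) f (orbit_point n ?F \<sigma> ` {v. det (mat n n v) = 1})"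
    then obtain c d where \<sigma>: "\<sigma> \<subseteq> ?F" "{0..<n} \<in> \<sigma>"
      and cd: "c < n" "d < n" "c \<noteq> d" "least_member \<sigma> c = least_member \<sigma> d" by blast
    let ?R = "{(i, j). j < n \<and> i \<in> least_member \<sigma> j \<and> i \<noteq> j}"
    have bound: "m + card ?R + 2 \<le> n * n" by (rule degenerate_orbit_bound[OF inf Pow \<sigma> cd f])
    have "?R \<subseteq> {0..<n} \<times> {0..<n}" using least_member_subset[OF \<sigma>(2)] by force
    then have finR: "finite ?R" by (rule finite_subset) simp
    have "S \<subseteq> ?R"
    proof clarify
      fix i j assume ij: "(i, j) \<in> S"
      have "i \<in> V" if "V \<in> \<sigma>" "j \<in> V" for V
        using that \<sigma>(1) ij union_family_iff[OF S, of V] by blast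
      then show "j < n \<and> i \<in> least_member \<sigma> j \<and> i \<noteq> j"
        using closed_root_subsetD[OF S ij] by (simp add: least_member_def)
    qed
    moreover have "(c, d) \<in> ?R" "(d, c) \<in> ?R" using cd in_least_member[of c \<sigma>] in_least_member[of d \<sigma>] by auto
    moreover have "(c, d) \<notin> S \<or> (d, c) \<notin> S" using closed_root_subsetD(1)[OF S] by (meson less_asym)
    ultimately have "S \<subset> ?R" by blast
    then have "card S < card ?R" by (rule psubset_card_mono[OF finR])
    then show "ereal (real m) \<le> ereal (?N - 2)"
      using bound card_chart_index[OF S assms(2)] by simp
  qed
  also have "ereal (?N - 2) = ereal ?N - 2" by (metis ereal_minus(1) numeral_eq_ereal)
  also have "\<dots> \<le> zariski_dim (W_index n ?F) (SL_orbit n ?F :: (_ \<Rightarrow> 'k) set) - 2"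
    by (rule ereal_minus_mono[OF zariski_dim_SL_orbit_ge[OF inf S assms(2)] order_refl])
  finally show ?thesis .
qed

end
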